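(* Let $E$ be a reflexive separable Banach space, let $(\mathcal{X},\mathcal{T})$ be a topological space with $\mathcal{X}\subset L_0(\Omega,E)$, and let $x\in\mathcal{X}$ be such that every sequence of $\mathcal{X}$ which $\mathcal{T}$-converges to $x$ converges to $x$ in the Biting sense. Let $(f_n)_n$ be a sequence of $\mathbb{T}\otimes\mathcal{B}(E)$-measurable integrands $f_n:\Omega\times E\to\overline{\mathbb{R}}$ satisfying the $\mathcal{T}$-Ioffe's criterion at $x$, and let $f=seq\,\sigma\text{-}li_e f_n$. Then $$\big(seq\,\mathcal{T}\text{-}li_e I_{f_n}\big)(x)\ \ge\ I_{f^{**}}(x).$$
   Context: $(\Omega,\mathbb{T},\mu)$ is a measure space with $\mu$ a $\sigma$-finite positive measure and $\mathbb{T}$ $\mu$-complete. $L_0(\Omega,E)$ is the space of classes (for a.e. equality) of measurable functions $\Omega\to E$. For an integrand $f$ and $x\in L_0(\Omega,E)$, $f(x)$ is the function $\omega\mapsto f(\omega,x(\omega))$ and $I_f(x)=\int^*_\Omega f(x)\,d\mu$, where $\int^*_\Omega v\,d\mu=\inf\{\int_\Omega u\,d\mu: u\in L_1(\Omega,\mathbb{R}),\ u\ge v\text{ a.e.}\}$. $v^-=\max(-v,0)$. For functionals $J_n$ on $\mathcal{X}$, $(seq\,\mathcal{T}\text{-}li_e J_n)(x)=\inf\{\liminf_n J_n(x_n): (x_n)_n\text{ in }\mathcal{X},\ x_n\to x\text{ for }\mathcal{T}\}$. With $\sigma=\sigma(E,E^* )$ the weak topology, $f(\omega,e)=(seq\,\sigma\text{-}li_e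 f_n(\omega,\cdot))(e)=\inf\{\liminf_n f_n(\omega,e_n): e_n\to e\text{ weakly}\}$. $f^*(\omega,e^* )=\sup_{e\in E}(\langle e^*,e\rangle-f(\omega,e))$ and $f^{**}(\omega,e)=\sup_{e^*\in E^*}(\langle e^*,e\rangle-f^*(\omega,e^* ))$. Biting convergence: $(x_n)_n$ converges to $x$ in the Biting sense if there is an increasing covering (up to a negligible set) $(\Omega_k)_k$ of $\Omega$ by measurable sets such that, for all $k$, the restrictions $x_n|_{\Omega_k}$ converge to $x|_{\Omega_k}$ for $\sigma(L_1(\Omega_k,E),L_1(\Omega_k,E)^* )$. A subset $X$ of $L_1(\Omega,\mathbb{R})$ is equi-integrable if for every $\epsilon>0$ there are $\eta>0$ and a measurable set $K$ of finite measure with $\sup_{u\in X}\|u1_A\|_1<\epsilon$ for every measurable $A$ with $\mu(A)\le\eta$, and $\sup_{u\in X}\|u1_{K^c}\|_1<\epsilon$; it is uniformly integrable if it is bounded in $L_1$ and equi-integrable. A sequence $(x_n)_n$ has the lower compactness property with respect to $(f_n)_n$ if there is $n_0$ such that $(f_n^-(x_n))_{n\ge n_0}$ is uniformly integrable in $L_1(\Omega,\mathbb{R})$. $\mathcal{T}$-Ioffe's criterion at $x$: for every subsequence $(f_{n_k})_k$ and every sequence $(x_k)_k$ of $\mathcal{X}$ $\mathcal{T}$-converging to $x$ such that $(I_{f_{n_k}}(x_k))_k$ is bounded above, $(x_k)_k$ has the lower compactness property with respect to $(f_{n_k})_k$. *)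

theory Defs
  imports "HOL-Analysis.Analysis"
begin

section \<open>Reflexivity and weak topologies\<close>

definition reflexive_space :: "'e::real_normed_vector itself \<Rightarrow> bool" where
  "reflexive_space _ \<longleftrightarrow>
     (\<forall>\<Phi> :: ('e \<Rightarrow>\<^sub>L real) \<Rightarrow>\<^sub>L real. \<exists>e. \<forall>\<phi>. blinfun_apply \<Phi> \<phi> = blinfun_apply \<phi> e)"

text \<open>The coarsest topology on the set \<open>V\<close> making every functional in \<open>D\<close> continuous,
  i.e. \<open>\<sigma>(V, D)\<close>; its carrier is \<open>V\<close> as soon as \<open>D\<close> is nonempty.\<close>

definition initial_topology :: "'v set \<Rightarrow> ('v \<Rightarrow> real) set \<Rightarrow> 'v topology" where
  "initial_topology V D = topology_generated_by {{v \<in> V. \<phi> v \<in> U} | \<phi> U. \<phi> \<in> D \<and> open U}"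

definition weak_topology :: "'e::real_normed_vector topology" where
  "weak_topology = initial_topology UNIV (range (blinfun_apply :: ('e \<Rightarrow>\<^sub>L real) \<Rightarrow> 'e \<Rightarrow> real))"


section \<open>The spaces of (classes of) measurable and integrable functions\<close>

definition ae_equal :: "'a measure \<Rightarrow> (('a \<Rightarrow> 'e::topological_space) \<times> ('a \<Rightarrow> 'e)) set" where
  "ae_equal M = {(x, y). x \<in> borel_measurable M \<and> y \<in> borel_measurable M \<and> (AE \<omega> in M. x \<omega> = y \<omega>)}"

definition L0 :: "'a measure \<Rightarrow> ('a \<Rightarrow> 'e::topological_space) set set" where
  "L0 M = borel_measurable M // ae_equal M"

text \<open>A representative of a class. All notions below which are applied to \<open>rep c\<close> are invariant
  under a.e. modification, hence do not depend on the choice.\<close>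

definition rep :: "('a \<Rightarrow> 'e) set \<Rightarrow> 'a \<Rightarrow> 'e" where
  "rep c = (SOME x. x \<in> c)"

text \<open>\<open>L1\<close> is the set of integrable functions, not of their classes. The bound by the
  \<open>L\<^sub>1\<close>-seminorm forces the elements of \<open>L1_dual\<close> to be constant on classes, so that
  they are exactly the continuous linear functionals on the Banach space of classes.\<close>

definition L1 :: "'a measure \<Rightarrow> ('a \<Rightarrow> 'e::{banach, second_countable_topology}) set" where
  "L1 M = {x. integrable M x}"

definition L1_dual ::
  "'a measure \<Rightarrow> (('a \<Rightarrow> 'e::{banach, second_countable_topology}) \<Rightarrow> real) set" where
  "L1_dual M = {\<Lambda>.
     (\<forall>x\<in>L1 M. \<forall>y\<in>L1 M. \<Lambda> (\<lambda>\<omega>. x \<omega> + y \<omega>) = \<Lambda> x + \<Lambda> y) \<and>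
     (\<forall>x\<in>L1 M. \<forall>c. \<Lambda> (\<lambda>\<omega>. c *\<^sub>R x \<omega>) = c * \<Lambda> x) \<and>
     (\<exists>C. \<forall>x\<in>L1 M. \<bar>\<Lambda> x\<bar> \<le> C * (\<integral>\<omega>. norm (x \<omega>) \<partial>M))}"

definition weakly_converges_L1 :: "'a measure \<Rightarrow>
    (nat \<Rightarrow> 'a \<Rightarrow> 'e::{banach, second_countable_topology}) \<Rightarrow> ('a \<Rightarrow> 'e) \<Rightarrow> bool" where
  "weakly_converges_L1 M xs x \<longleftrightarrow>
     (\<forall>n. xs n \<in> L1 M) \<and> limitin (initial_topology (L1 M) (L1_dual M)) xs x sequentially"

definition biting_converges :: "'a measure \<Rightarrow>
    (nat \<Rightarrow> 'a \<Rightarrow> 'e::{banach, second_countable_topology}) \<Rightarrow> ('a \<Rightarrow> 'e) \<Rightarrow> bool" where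
  "biting_converges M xs x \<longleftrightarrow>
     (\<exists>\<Omega> :: nat \<Rightarrow> 'a set. incseq \<Omega> \<and> (\<forall>k. \<Omega> k \<in> sets M) \<and> (AE \<omega> in M. \<omega> \<in> (\<Union>k. \<Omega> k)) \<and>
        (\<forall>k. weakly_converges_L1 (restrict_space M (\<Omega> k)) xs x))"


section \<open>Integral functionals, conjugates and sequential lower epi-limits\<close>

definition upper_integral :: "'a measure \<Rightarrow> ('a \<Rightarrow> ereal) \<Rightarrow> ereal" where
  "upper_integral M v =
     Inf {ereal (\<integral>\<omega>. u \<omega> \<partial>M) | u :: 'a \<Rightarrow> real. integrable M u \<and> (AE \<omega> in M. v \<omega> \<le> ereal (u \<omega>))}"

definition integral_functional ::
  "'a measure \<Rightarrow> ('a \<Rightarrow> 'e \<Rightarrow> ereal) \<Rightarrow> ('a \<Rightarrow> 'e) set \<Rightarrow> ereal" where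
  "integral_functional M f c = upper_integral M (\<lambda>\<omega>. f \<omega> (rep c \<omega>))"

definition seq_li_e :: "'x topology \<Rightarrow> (nat \<Rightarrow> 'x \<Rightarrow> ereal) \<Rightarrow> 'x \<Rightarrow> ereal" where
  "seq_li_e T J x =
     Inf {liminf (\<lambda>n. J n (xs n)) | xs. (\<forall>n. xs n \<in> topspace T) \<and> limitin T xs x sequentially}"

definition conjugate :: "('e::real_normed_vector \<Rightarrow> ereal) \<Rightarrow> ('e \<Rightarrow>\<^sub>L real) \<Rightarrow> ereal" where
  "conjugate g \<phi> = (SUP e. ereal (blinfun_apply \<phi> e) - g e)"

definition biconjugate :: "('e::real_normed_vector \<Rightarrow> ereal) \<Rightarrow> 'e \<Rightarrow> ereal" where
  "biconjugate g e = (SUP \<phi>. ereal (blinfun_apply \<phi> e) - conjugate g \<phi>)"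


section \<open>Uniform integrability and Ioffe's criterion\<close>

definition equi_integrable :: "'a measure \<Rightarrow> ('a \<Rightarrow> real) set \<Rightarrow> bool" where
  "equi_integrable M X \<longleftrightarrow> X \<subseteq> L1 M \<and>
     (\<forall>\<epsilon>::real. \<epsilon> > 0 \<longrightarrow> (\<exists>\<eta>::real. \<exists>K. \<eta> > 0 \<and> K \<in> sets M \<and> emeasure M K < \<infinity> \<and>
        (\<forall>A\<in>sets M. emeasure M A \<le> ennreal \<eta> \<longrightarrow>
           (SUP u\<in>X. \<integral>\<^sup>+\<omega>. ennreal \<bar>u \<omega> * indicator A \<omega>\<bar> \<partial>M) < ennreal \<epsilon>) \<and>
        (SUP u\<in>X. \<integral>\<^sup>+\<omega>. ennreal \<bar>u \<omega> * indicator (space M - K) \<omega>\<bar> \<partial>M) < ennreal \<epsilon>))"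

definition uniformly_integrable :: "'a measure \<Rightarrow> ('a \<Rightarrow> real) set \<Rightarrow> bool" where
  "uniformly_integrable M X \<longleftrightarrow>
     (\<exists>C::real. \<forall>u\<in>X. (\<integral>\<omega>. \<bar>u \<omega>\<bar> \<partial>M) \<le> C) \<and> equi_integrable M X"

definition neg_part :: "ereal \<Rightarrow> ereal" where
  "neg_part v = max (- v) 0"

text \<open>The functions \<open>f\<^sub>n\<^sup>-(x\<^sub>n)\<close> have values in \<open>[0, \<infinity>]\<close>; membership in
  \<open>L\<^sub>1(\<Omega>, \<real>)\<close> requires them to be finite a.e., which \<open>real_of_ereal\<close> alone
  would not detect.\<close>

definition lower_compactness :: "'a measure \<Rightarrow>
    (nat \<Rightarrow> 'a \<Rightarrow> 'e \<Rightarrow> ereal) \<Rightarrow> (nat \<Rightarrow> 'a \<Rightarrow> 'e) \<Rightarrow> bool" where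
  "lower_compactness M f xs \<longleftrightarrow>
     (\<exists>n0. (\<forall>n\<ge>n0. AE \<omega> in M. neg_part (f n \<omega> (xs n \<omega>)) < \<infinity>) \<and>
        uniformly_integrable M ((\<lambda>n \<omega>. real_of_ereal (neg_part (f n \<omega> (xs n \<omega>)))) ` {n0..}))"

definition ioffe_criterion :: "'a measure \<Rightarrow> ('a \<Rightarrow> 'e) set topology \<Rightarrow>
    (nat \<Rightarrow> 'a \<Rightarrow> 'e \<Rightarrow> ereal) \<Rightarrow> ('a \<Rightarrow> 'e) set \<Rightarrow> bool" where
  "ioffe_criterion M T f x \<longleftrightarrow>
     (\<forall>r :: nat \<Rightarrow> nat. \<forall>xs. strict_mono r \<longrightarrow> (\<forall>k. xs k \<in> topspace T) \<longrightarrow>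
        limitin T xs x sequentially \<longrightarrow>
        (\<exists>C::real. \<forall>k. integral_functional M (f (r k)) (xs k) \<le> ereal C) \<longrightarrow>
        lower_compactness M (\<lambda>k. f (r k)) (\<lambda>k. rep (xs k)))"

end

theory Submission
  imports Defs "HOL-Library.Function_Algebras" "HOL-Complex_Analysis.Great_Picard"
begin

text \<open>Convex averages supplied by Mazur's lemma are combined with Fatou's lemma, and the epi-limit enters
only through a pointwise inequality.

Suppose that \<open>liminf\<^sub>n I\<^bsub>f\<^sub>n\<^esub>(x\<^sub>n) < B\<close>. Along a subsequence all integrals are below \<open>B\<close>, and Ioffe's
criterion makes the negative parts of \<open>v\<^sub>m = f\<^bsub>r m\<^esub>(x\<^bsub>r m\<^esub>)\<close> uniformly integrable, where \<open>r\<close> enumerates the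
subsequence; from now on \<open>x\<^sub>m\<close> stands for \<open>x\<^bsub>r m\<^esub>\<close>. Hence, for
\<open>\<epsilon> > 0\<close>, one integrable \<open>H \<ge> 0\<close> satisfies \<open>\<integral> (v\<^sub>m\<^sup>- - H)\<^sup>+ \<le> \<epsilon>\<close> for all \<open>m\<close>
(\<open>uniformly_integrable_dominated_up_to\<close>), so that \<open>p\<^sub>m = max v\<^sub>m (-H) + H\<close> is nonnegative with integral
at most \<open>B + \<epsilon> + \<integral> H\<close>. It suffices to find a function \<open>G\<close> with \<open>\<integral> G \<le> B + \<epsilon> + \<integral> H\<close> and
\<open>f\<^sup>*\<^sup>*(x) \<le> G - H\<close> almost everywhere.

On each set \<open>\<Omega>\<^sub>k\<close> of the Biting covering the \<open>x\<^sub>m\<close> converge weakly in \<open>L\<^sub>1\<close>. By Mazur's lemma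
(\<open>mazur_L1\<close>) there are convex weights \<open>w\<^sub>j\<close>, supported on indices \<open>m \<ge> j\<close>, such that
\<open>\<Sum>\<^sub>m w\<^sub>j m x\<^sub>m \<rightarrow> x\<close> almost everywhere. The function is
\<open>G = sup\<^sub>K inf\<^sub>R liminf\<^sub>j \<Sum>\<^sub>m w\<^sub>j m (p\<^sub>m + K \<parallel>x\<^sub>m\<parallel> 1{\<parallel>x\<^sub>m\<parallel> > R + 1})\<close>.

The penalty term serves the pointwise inequality (\<open>conjugate_bound_penalized_average\<close>). Fix \<open>\<omega>\<close>, a
functional \<open>\<phi>\<close> and a real \<open>c \<ge> f\<^sup>*(\<omega>, \<phi>)\<close>. Bounded sequences in a separable reflexive space have weakly
convergent subsequences, so \<open>\<phi>(x\<^sub>m) - v\<^sub>m \<le> c + \<delta>\<close> for all large \<open>m\<close> with \<open>\<parallel>x\<^sub>m\<parallel> \<le> R + 1\<close>; for the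
other \<open>m\<close> the penalty dominates \<open>\<phi>(x\<^sub>m) - c + H\<close> once \<open>K\<close> is large, and \<open>K\<close> may depend on \<open>\<omega>\<close>, \<open>\<phi>\<close> and
\<open>c\<close>. Averaging and \<open>j \<rightarrow> \<infinity>\<close> give \<open>\<phi>(x) - c + H \<le> G\<close>.

The penalty does not contribute to the integral (\<open>nn_integral_penalized_averages_le\<close>), because a weakly
convergent sequence in \<open>L\<^sub>1\<close> is uniformly integrable
(\<open>weakly_convergent_L1_uniformly_integrable\<close>): on \<open>\<Omega>\<^sub>k\<close> its integral is at most \<open>K \<eta>\<close> as soon as \<open>R\<close> and
\<open>j\<close> are large, for any \<open>\<eta> > 0\<close>. The uniform integrability is proved by a gliding hump in the dual ball.
Mazur's lemma, the norming functionals of the hump and the separability of the dual of a separable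
reflexive space all come from one convex separation lemma (\<open>convex_separation\<close>).\<close>


section \<open>Separation of a convex set from the origin\<close>

text \<open>An explicit carrier and an abstract scalar multiplication are used because the integrable functions
form a subspace, depending on the measure, of a function type with pointwise operations; the same
lemmas are later applied to whole normed spaces.\<close>
locale real_subspace = vector_space scale
  for scale :: "real \<Rightarrow> 'v::ab_group_add \<Rightarrow> 'v" (infixr "\<odot>" 75) +
  fixes V :: "'v set"
  assumes V: "subspace V"
begin

definition sublinear :: "('v \<Rightarrow> real) \<Rightarrow> bool" where
  "sublinear q \<longleftrightarrow> (\<forall>a\<in>V. \<forall>b\<in>V. q (a + b) \<le> q a + q b) \<and> (\<forall>a\<in>V. \<forall>t\<ge>0. q (t \<odot> a) = t * q a)"

definition linear_on_V :: "('v \<Rightarrow> real) \<Rightarrow> bool" where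
  "linear_on_V L \<longleftrightarrow> (\<forall>a\<in>V. \<forall>b\<in>V. L (a + b) = L a + L b) \<and> (\<forall>a\<in>V. \<forall>t. L (t \<odot> a) = t * L a)"

definition seminorm :: "('v \<Rightarrow> real) \<Rightarrow> bool" where
  "seminorm N \<longleftrightarrow> (\<forall>a\<in>V. \<forall>b\<in>V. N (a + b) \<le> N a + N b) \<and> (\<forall>a\<in>V. \<forall>t. N (t \<odot> a) = \<bar>t\<bar> * N a)"

lemma sublinear_lower_bound:
  assumes "sublinear q" "a \<in> V" "b \<in> V"
  shows "q (a + b) \<ge> q a - q (- b)"
proof -
  have "- b \<in> V" using V assms subspace_neg by blast
  moreover have "a + b \<in> V" using V assms subspace_add by blast
  ultimately have "q ((a + b) + (- b)) \<le> q (a + b) + q (- b)"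
    using assms(1) unfolding sublinear_def by blast
  then show ?thesis by simp
qed

lemma sublinear_0: "sublinear q \<Longrightarrow> q 0 = 0"
proof -
  assume "sublinear q"
  then have "\<forall>t\<ge>0. q (t \<odot> 0) = t * q 0"
    using V subspace_0 unfolding sublinear_def by blast
  from this[rule_format, of 0] show ?thesis by simp
qed

definition minimal_sublinear :: "('v \<Rightarrow> real) \<Rightarrow> bool" where
  "minimal_sublinear q \<longleftrightarrow> sublinear q \<and>
     (\<forall>q'. sublinear q' \<longrightarrow> (\<forall>v\<in>V. q' v \<le> q v) \<longrightarrow> (\<forall>v\<in>V. q' v = q v))"

text \<open>For fixed \<open>a\<close>, the function \<open>Q y = inf\<^bsub>t \<ge> 0\<^esub> (q (y + t a) - t q a)\<close> is sublinear and below \<open>q\<close>, hence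
equal to \<open>q\<close>; the term \<open>t = 1\<close> gives \<open>q y + q a \<le> q (y + a)\<close>. So \<open>q\<close> is additive.\<close>
lemma minimal_sublinear_is_linear:
  assumes min: "minimal_sublinear q"
  shows "linear_on_V q"
proof -
  have q: "sublinear q" using min by (simp add: minimal_sublinear_def)
  have sub: "q (a + b) \<le> q a + q b" if "a \<in> V" "b \<in> V" for a b
    using q that unfolding sublinear_def by blast
  have hom: "q (t \<odot> a) = t * q a" if "a \<in> V" "t \<ge> 0" for a t
    using q that unfolding sublinear_def by blast
  note [simp] = subspace_add[OF V] subspace_scale[OF V] subspace_neg[OF V] subspace_0[OF V]
  have add: "q (b + a) = q b + q a" if a: "a \<in> V" and b: "b \<in> V" for a b
  proof -
    define Q where "Q y = (INF t\<in>{0..}. q (y + t \<odot> a) - t * q a)" for y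
    have bdd: "bdd_below ((\<lambda>t. q (y + t \<odot> a) - t * q a) ` {0..})" if y: "y \<in> V" for y
    proof (rule bdd_belowI2)
      fix t :: real assume "t \<in> {0..}"
      then have "q (t \<odot> a + y) \<ge> q (t \<odot> a) - q (- y)" "q (t \<odot> a) = t * q a"
        using a y by (auto intro!: sublinear_lower_bound[OF q] hom)
      then show "- q (- y) \<le> q (y + t \<odot> a) - t * q a" by (simp add: add.commute)
    qed
    have le: "Q y \<le> q (y + t \<odot> a) - t * q a" if "y \<in> V" "t \<ge> 0" for y t
      unfolding Q_def using that by (intro cINF_lower bdd) auto
    have "sublinear Q"
      unfolding sublinear_def
    proof (intro conjI ballI allI impI)
      fix y z assume yz: "y \<in> V" "z \<in> V"
      have "Q (y + z) - (q (z + t \<odot> a) - t * q a) \<le> q (y + s \<odot> a) - s * q a"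
        if st: "s \<ge> 0" "t \<ge> 0" for s t
      proof -
        have "Q (y + z) \<le> q ((y + z) + (s + t) \<odot> a) - (s + t) * q a"
          using yz st by (intro le) auto
        also have "(y + z) + (s + t) \<odot> a = (y + s \<odot> a) + (z + t \<odot> a)"
          by (simp add: scale_left_distrib algebra_simps)
        also have "q ((y + s \<odot> a) + (z + t \<odot> a)) \<le> q (y + s \<odot> a) + q (z + t \<odot> a)"
          using yz a by (intro sub) auto
        finally show ?thesis by (simp add: algebra_simps)
      qed
      then have "Q (y + z) - (q (z + t \<odot> a) - t * q a) \<le> Q y" if "t \<ge> 0" for t
        unfolding Q_def[of y] using that by (intro cINF_greatest) auto
      then have "Q (y + z) - Q y \<le> q (z + t \<odot> a) - t * q a" if "t \<ge> 0" for t
        using that by (simp add: algebra_simps)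
      then have "Q (y + z) - Q y \<le> Q z"
        unfolding Q_def[of z] by (intro cINF_greatest) auto
      then show "Q (y + z) \<le> Q y + Q z" by simp
    next
      fix y and s :: real assume y: "y \<in> V" and s: "s \<ge> 0"
      have pos: "Q (r \<odot> y) \<le> r * Q y" if y: "y \<in> V" and r: "r > 0" for r y
      proof -
        have "Q (r \<odot> y) / r \<le> q (y + t \<odot> a) - t * q a" if "t \<ge> 0" for t
        proof -
          have "Q (r \<odot> y) \<le> q (r \<odot> y + (r * t) \<odot> a) - (r * t) * q a"
            using y r that by (intro le) auto
          also have "r \<odot> y + (r * t) \<odot> a = r \<odot> (y + t \<odot> a)"
            by (simp add: scale_right_distrib)
          also have "q (r \<odot> (y + t \<odot> a)) = r * q (y + t \<odot> a)"
            using y a r by (intro hom) auto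
          finally show ?thesis using r by (simp add: field_simps)
        qed
        then have "Q (r \<odot> y) / r \<le> Q y"
          unfolding Q_def[of y] by (intro cINF_greatest) auto
        then show ?thesis using r by (simp add: field_simps)
      qed
      show "Q (s \<odot> y) = s * Q y"
      proof (cases "s = 0")
        case True
        have "Q 0 \<le> 0" using le[of 0 0] a by (simp add: sublinear_0[OF q])
        moreover have "0 \<le> Q 0" unfolding Q_def using a hom by (intro cINF_greatest) auto
        ultimately show ?thesis using True by simp
      next
        case False
        then have "Q ((1 / s) \<odot> (s \<odot> y)) \<le> (1 / s) * Q (s \<odot> y)"
          using y s by (intro pos) auto
        then have "s * Q y \<le> Q (s \<odot> y)" using False s by (simp add: field_simps)
        moreover have "Q (s \<odot> y) \<le> s * Q y" using False s y by (intro pos) auto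
        ultimately show ?thesis by simp
      qed
    qed
    moreover have "Q v \<le> q v" if "v \<in> V" for v using le[OF that, of 0] by simp
    ultimately have "Q b = q b" using min b unfolding minimal_sublinear_def by blast
    moreover have "Q b \<le> q (b + a) - q a" using le[OF b, of 1] by simp
    ultimately show ?thesis using sub[OF b a] by simp
  qed
  have neg: "q (- a) = - q a" if "a \<in> V" for a
    using add[of "- a" a] that sublinear_0[OF q] by simp
  show ?thesis unfolding linear_on_V_def
  proof (intro conjI ballI allI)
    fix a and t :: real assume a: "a \<in> V"
    show "q (t \<odot> a) = t * q a"
    proof (cases "t \<ge> 0")
      case False
      then have "q ((- t) \<odot> a) = (- t) * q a" using a by (intro hom) auto
      moreover have "q (- (t \<odot> a)) = - q (t \<odot> a)" using a by (intro neg) auto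
      ultimately show ?thesis by simp
    qed (use a hom in auto)
  qed (use add in auto)
qed

text \<open>Zorn's lemma for the reversed pointwise order: the infimum of a chain is finite since
\<open>q v \<ge> - q (- v) \<ge> - p (- v)\<close>, and it is subadditive since two members of a chain have a common lower bound
in the chain. The functions are normalised to \<open>0\<close> off \<open>V\<close>, so that the order is antisymmetric.\<close>
lemma exists_minimal_sublinear:
  assumes p: "sublinear p"
  obtains q where "minimal_sublinear q" "\<And>v. v \<in> V \<Longrightarrow> q v \<le> p v"
proof -
  define A where "A = {q. sublinear q \<and> (\<forall>v\<in>V. q v \<le> p v) \<and> (\<forall>v. v \<notin> V \<longrightarrow> q v = 0)}"
  let ?P = "\<lambda>q q' :: 'v \<Rightarrow> real. q' \<le> q"
  let ?r = "relation_of ?P A"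
  note [simp] = subspace_add[OF V] subspace_scale[OF V] subspace_neg[OF V] subspace_0[OF V]
  have restrict: "(\<lambda>v. if v \<in> V then q v else 0) \<in> A"
    if "sublinear q" "\<forall>v\<in>V. q v \<le> p v" for q
    using that unfolding A_def sublinear_def by auto
  have "\<exists>m\<in>A. \<forall>a\<in>A. ?P m a \<longrightarrow> a = m"
  proof (rule predicate_Zorn)
    show "partial_order_on A ?r"
      by (auto simp: partial_order_on_def preorder_on_def refl_on_def trans_def antisym_def
          relation_of_def intro: order_trans)
  next
    fix C assume "C \<in> Chains ?r"
    then have CA: "C \<subseteq> A" and chain: "\<And>a b. a \<in> C \<Longrightarrow> b \<in> C \<Longrightarrow> a \<le> b \<or> b \<le> a"
      unfolding Chains_def relation_of_def by auto
    show "\<exists>u\<in>A. \<forall>a\<in>C. u \<le> a"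
    proof (cases "C = {}")
      case True
      then show ?thesis using restrict[OF p] by auto
    next
      case False
      define u where "u v = (INF q\<in>C. q v)" for v
      have bdd: "bdd_below ((\<lambda>q. q v) ` C)" for v
      proof (rule bdd_belowI2)
        fix q assume "q \<in> C"
        then have qA: "q \<in> A" using CA by blast
        show "(if v \<in> V then - p (- v) else 0) \<le> q v"
        proof (cases "v \<in> V")
          case True
          then have "q (0 + v) \<ge> q 0 - q (- v)" "q 0 = 0"
            using qA sublinear_lower_bound[of q 0 v] sublinear_0[of q] by (auto simp: A_def)
          moreover have "q (- v) \<le> p (- v)" using qA True by (auto simp: A_def)
          ultimately show ?thesis using True by simp
        qed (use qA in \<open>auto simp: A_def\<close>)
      qed
      have le: "u v \<le> q v" if "q \<in> C" for q v
        unfolding u_def using that by (intro cINF_lower bdd)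
      have "sublinear u" unfolding sublinear_def
      proof (intro conjI ballI allI impI)
        fix a b assume ab: "a \<in> V" "b \<in> V"
        have "u (a + b) - q2 b \<le> q1 a" if q: "q1 \<in> C" "q2 \<in> C" for q1 q2
        proof -
          obtain q where qC: "q \<in> C" and "q \<le> q1" "q \<le> q2" using chain[OF q] q by auto
          then have "q a \<le> q1 a" "q b \<le> q2 b" by (auto simp: le_fun_def)
          moreover have "q (a + b) \<le> q a + q b"
            using CA ab qC by (auto simp: A_def sublinear_def)
          ultimately show ?thesis using le[OF qC, of "a + b"] by linarith
        qed
        then have "u (a + b) - q2 b \<le> u a" if "q2 \<in> C" for q2
          unfolding u_def[of a] using that False by (intro cINF_greatest) auto
        then have "u (a + b) - u a \<le> u b"
          unfolding u_def[of b] using False by (intro cINF_greatest) (auto simp: algebra_simps)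
        then show "u (a + b) \<le> u a + u b" by simp
      next
        fix a and t :: real assume a: "a \<in> V" and t: "t \<ge> 0"
        have "q (t \<odot> a) = t * q a" if "q \<in> C" for q
          using CA that a t by (auto simp: A_def sublinear_def)
        then have "u (t \<odot> a) = (INF q\<in>C. t * q a)" unfolding u_def by simp
        also have "\<dots> = t * u a"
        proof (rule antisym)
          show "t * u a \<le> (INF q\<in>C. t * q a)"
            using False t le by (intro cINF_greatest) (auto intro: mult_left_mono)
          have *: "(INF q\<in>C. t * q a) \<le> t * q a" if "q \<in> C" for q
          proof (rule cINF_lower[OF _ that], rule bdd_belowI2)
            fix q assume "q \<in> C"
            show "t * u a \<le> t * q a" using le[OF \<open>q \<in> C\<close>] t by (auto intro: mult_left_mono)
          qed
          show "(INF q\<in>C. t * q a) \<le> t * u a"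
          proof (cases "t = 0")
            case True
            then show ?thesis using False by simp
          next
            case tn: False
            have "(INF q\<in>C. t * q a) / t \<le> u a"
              unfolding u_def[of a] using * tn t False
              by (intro cINF_greatest) (auto simp: divide_le_eq mult.commute)
            then show ?thesis using tn t by (simp add: divide_le_eq mult.commute)
          qed
        qed
        finally show "u (t \<odot> a) = t * u a" .
      qed
      moreover have "\<forall>v\<in>V. u v \<le> p v"
      proof
        fix v assume v: "v \<in> V"
        obtain q where "q \<in> C" using False by blast
        then show "u v \<le> p v" using le[of q v] CA v by (force simp: A_def)
      qed
      moreover have "\<forall>v. v \<notin> V \<longrightarrow> u v = 0"
      proof (intro allI impI)
        fix v assume v: "v \<notin> V"
        have "u v = (INF q\<in>C. 0)" unfolding u_def
          using CA v by (intro INF_cong) (auto simp: A_def)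
        then show "u v = 0" using False by simp
      qed
      ultimately have "u \<in> A" by (simp add: A_def)
      then show ?thesis using le by (auto simp: le_fun_def)
    qed
  qed
  then obtain m where m: "m \<in> A" and min: "\<And>a. a \<in> A \<Longrightarrow> a \<le> m \<Longrightarrow> a = m" by blast
  show ?thesis
  proof (rule that)
    show "\<And>v. v \<in> V \<Longrightarrow> m v \<le> p v" using m by (auto simp: A_def)
    have "q' v = m v" if q': "sublinear q'" "\<forall>v\<in>V. q' v \<le> m v" and v: "v \<in> V" for q' v
    proof -
      define q where "q = (\<lambda>v. if v \<in> V then q' v else 0)"
      have "q \<in> A" unfolding q_def using q' m by (intro restrict) (force simp: A_def)+
      moreover have "q \<le> m" using q' m by (auto simp: le_fun_def q_def A_def)
      ultimately have "q = m" by (rule min)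
      then have "q v = m v" by simp
      then show ?thesis using v by (simp add: q_def)
    qed
    then show "minimal_sublinear m" using m unfolding minimal_sublinear_def A_def by blast
  qed
qed

text \<open>Hahn--Banach for the sublinear function \<open>p y = inf (N (y + t c) - t d)\<close>, the infimum over \<open>t \<ge> 0\<close> and
\<open>c \<in> C\<close>. It lies between \<open>- N\<close> and \<open>N\<close> because \<open>N (t c) \<ge> t d\<close>, convexity of \<open>C\<close> gives subadditivity,
and \<open>t = 1\<close> shows \<open>p (- c) \<le> - d\<close>. A linear function below \<open>p\<close> is therefore at least \<open>d\<close> on \<open>C\<close>.\<close>
theorem convex_separation:
  assumes N: "seminorm N" and C: "C \<subseteq> V" "C \<noteq> {}"
    and conv: "\<And>a b t. a \<in> C \<Longrightarrow> b \<in> C \<Longrightarrow> 0 \<le> t \<Longrightarrow> t \<le> 1 \<Longrightarrow> (1 - t) \<odot> a + t \<odot> b \<in> C"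
    and d: "\<And>c. c \<in> C \<Longrightarrow> d \<le> N c"
  obtains L where "linear_on_V L" "\<And>v. v \<in> V \<Longrightarrow> \<bar>L v\<bar> \<le> N v" "\<And>c. c \<in> C \<Longrightarrow> d \<le> L c"
proof -
  note [simp] = subspace_add[OF V] subspace_scale[OF V] subspace_neg[OF V] subspace_0[OF V]
  have sub: "N (a + b) \<le> N a + N b" if "a \<in> V" "b \<in> V" for a b
    using N that unfolding seminorm_def by blast
  have hom: "N (t \<odot> a) = \<bar>t\<bar> * N a" if "a \<in> V" for a t
    using N that unfolding seminorm_def by blast
  have neg: "N (- a) = N a" if "a \<in> V" for a using hom[OF that, of "-1"] by simp
  let ?I = "{0::real..} \<times> C"
  define p where "p y = (INF (t, c)\<in>?I. N (y + t \<odot> c) - t * d)" for y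
  have ne: "?I \<noteq> {}"
  proof -
    obtain c where "c \<in> C" using C by blast
    then have "(0, c) \<in> ?I" by simp
    then show ?thesis by blast
  qed
  have low: "- N y \<le> N (y + t \<odot> c) - t * d" if "y \<in> V" "t \<ge> 0" "c \<in> C" for y t c
  proof -
    have cV: "c \<in> V" using C that by blast
    have "N ((y + t \<odot> c) + (- y)) \<le> N (y + t \<odot> c) + N (- y)"
      using that cV by (intro sub) auto
    moreover have "t * d \<le> N (t \<odot> c)" using d[OF \<open>c \<in> C\<close>] that hom[OF cV] by (simp add: mult_left_mono)
    ultimately show ?thesis using neg that by simp
  qed
  have bdd: "bdd_below ((\<lambda>(t, c). N (y + t \<odot> c) - t * d) ` ?I)" if "y \<in> V" for y
    using low[OF that] by (intro bdd_belowI2[of _ "- N y"]) auto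
  have le: "p y \<le> N (y + t \<odot> c) - t * d" if "y \<in> V" "t \<ge> 0" "c \<in> C" for y t c
    unfolding p_def using that by (intro cINF_lower2[OF bdd, of _ "(t, c)"]) auto
  have ge: "b \<le> p y" if "\<And>t c. t \<ge> 0 \<Longrightarrow> c \<in> C \<Longrightarrow> b \<le> N (y + t \<odot> c) - t * d" for y b
    unfolding p_def using ne that by (intro cINF_greatest) auto
  have pN: "p v \<le> N v" if "v \<in> V" for v
  proof -
    obtain c where "c \<in> C" using C by auto
    then show ?thesis using le[OF that, of 0 c] by simp
  qed
  have "sublinear p" unfolding sublinear_def
  proof (intro conjI ballI allI impI)
    fix y z assume yz: "y \<in> V" "z \<in> V"
    have *: "p (y + z) \<le> (N (y + s \<odot> a) - s * d) + (N (z + t \<odot> b) - t * d)"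
      if st: "s \<ge> 0" "t \<ge> 0" "a \<in> C" "b \<in> C" for s t a b
    proof (cases "s + t = 0")
      case True
      then have "s = 0" "t = 0" using st by auto
      then show ?thesis using pN[of "y + z"] sub[of y z] yz by simp
    next
      case False
      then have p: "s + t > 0" using st by simp
      define r where "r = t / (s + t)"
      define c where "c = (1 - r) \<odot> a + r \<odot> b"
      have "c \<in> C" unfolding c_def r_def using st p by (intro conv) (auto simp: field_simps)
      then have "p (y + z) \<le> N ((y + z) + (s + t) \<odot> c) - (s + t) * d"
        using yz st by (intro le) auto
      also have "(s + t) \<odot> c = s \<odot> a + t \<odot> b"
      proof -
        have "(s + t) * (1 - r) = s" "(s + t) * r = t" unfolding r_def using p by (auto simp: field_simps)
        then show ?thesis unfolding c_def by (simp add: scale_right_distrib)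
      qed
      also have "N (y + z + (s \<odot> a + t \<odot> b)) \<le> N (y + s \<odot> a) + N (z + t \<odot> b)"
      proof -
        have "y + s \<odot> a \<in> V" "z + t \<odot> b \<in> V" using yz st C by auto
        from sub[OF this] show ?thesis by (simp add: algebra_simps)
      qed
      finally show ?thesis by (simp add: algebra_simps)
    qed
    have "p (y + z) - (N (z + t \<odot> b) - t * d) \<le> p y" if "t \<ge> 0" "b \<in> C" for t b
      using *[OF _ that(1) _ that(2)] by (intro ge) (simp add: algebra_simps)
    then have "p (y + z) - p y \<le> p z" by (intro ge) (simp add: algebra_simps)
    then show "p (y + z) \<le> p y + p z" by simp
  next
    fix y and s :: real assume y: "y \<in> V" and s: "s \<ge> 0"
    have pos: "p (r \<odot> y) \<le> r * p y" if y: "y \<in> V" and r: "r > 0" for r y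
    proof -
      have "p (r \<odot> y) / r \<le> p y"
      proof (rule ge)
        fix t :: real and c assume tc: "t \<ge> 0" "c \<in> C"
        have "p (r \<odot> y) \<le> N (r \<odot> y + (r * t) \<odot> c) - (r * t) * d"
          using y r tc by (intro le) auto
        also have "r \<odot> y + (r * t) \<odot> c = r \<odot> (y + t \<odot> c)"
          by (simp add: scale_right_distrib)
        also have "N (r \<odot> (y + t \<odot> c)) = r * N (y + t \<odot> c)"
          using y tc C r by (subst hom) auto
        finally show "p (r \<odot> y) / r \<le> N (y + t \<odot> c) - t * d" using r by (simp add: field_simps)
      qed
      then show ?thesis using r by (simp add: field_simps)
    qed
    show "p (s \<odot> y) = s * p y"
    proof (cases "s = 0")
      case True
      have N0: "N 0 = 0" using hom[of 0 0] by simp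
      have "p 0 \<le> 0" using pN[of 0] N0 by simp
      moreover have "0 \<le> p 0" using low[of 0] N0 by (intro ge) auto
      ultimately show ?thesis using True by simp
    next
      case False
      then have "p ((1 / s) \<odot> (s \<odot> y)) \<le> (1 / s) * p (s \<odot> y)"
        using y s by (intro pos) auto
      then have "s * p y \<le> p (s \<odot> y)" using False s by (simp add: field_simps)
      moreover have "p (s \<odot> y) \<le> s * p y" using False s y by (intro pos) auto
      ultimately show ?thesis by simp
    qed
  qed
  then obtain q where q: "minimal_sublinear q" "\<And>v. v \<in> V \<Longrightarrow> q v \<le> p v"
    using exists_minimal_sublinear by blast
  have lin: "linear_on_V q" using q(1) by (rule minimal_sublinear_is_linear)
  have qneg: "q (- v) = - q v" if "v \<in> V" for v
  proof -
    have "q ((-1) \<odot> v) = (-1) * q v" using lin that unfolding linear_on_V_def by blast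
    then show ?thesis by simp
  qed
  show ?thesis
  proof (rule that[OF lin])
    fix v assume v: "v \<in> V"
    show "\<bar>q v\<bar> \<le> N v"
      using q(2)[OF v] q(2)[of "- v"] pN[OF v] pN[of "- v"] v qneg[OF v] neg[OF v] by force
  next
    fix c assume c: "c \<in> C"
    then have cV: "c \<in> V" using C by blast
    have "q (- c) \<le> p (- c)" using cV q(2) by simp
    also have "p (- c) \<le> N (- c + 1 \<odot> c) - 1 * d" using c cV by (intro le) auto
    also have "\<dots> = - d" using hom[of 0 0] by simp
    finally show "d \<le> q c" using qneg[OF cV] by simp
  qed
qed

end


section \<open>Weakly convergent sequences in \<open>L\<^sub>1\<close>: Mazur's lemma and uniform integrability\<close>

abbreviation L1_norm :: "'a measure \<Rightarrow> ('a \<Rightarrow> 'e::{banach, second_countable_topology}) \<Rightarrow> real" where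
  "L1_norm N x \<equiv> (\<integral>\<omega>. norm (x \<omega>) \<partial>N)"

text \<open>The unit ball of the dual of \<open>L\<^sub>1\<close>: the constant of \<open>L1_dual\<close> is fixed to \<open>1\<close>, so that the gliding hump
below stays in one set that is closed under pointwise limits.\<close>
definition dual_ball ::
  "'a measure \<Rightarrow> (('a \<Rightarrow> 'e::{banach, second_countable_topology}) \<Rightarrow> real) set" where
  "dual_ball N = {\<Lambda>.
     (\<forall>x\<in>L1 N. \<forall>y\<in>L1 N. \<Lambda> (\<lambda>\<omega>. x \<omega> + y \<omega>) = \<Lambda> x + \<Lambda> y) \<and>
     (\<forall>x\<in>L1 N. \<forall>c. \<Lambda> (\<lambda>\<omega>. c *\<^sub>R x \<omega>) = c * \<Lambda> x) \<and>
     (\<forall>x\<in>L1 N. \<bar>\<Lambda> x\<bar> \<le> L1_norm N x)}"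

lemma dual_ball_subset_L1_dual: "dual_ball N \<subseteq> L1_dual N"
  unfolding dual_ball_def L1_dual_def by (auto intro!: exI[of _ 1])

lemma dual_ballD:
  assumes "\<Lambda> \<in> dual_ball N"
  shows "x \<in> L1 N \<Longrightarrow> y \<in> L1 N \<Longrightarrow> \<Lambda> (\<lambda>\<omega>. x \<omega> + y \<omega>) = \<Lambda> x + \<Lambda> y"
    and "x \<in> L1 N \<Longrightarrow> \<Lambda> (\<lambda>\<omega>. c *\<^sub>R x \<omega>) = c * \<Lambda> x"
    and "x \<in> L1 N \<Longrightarrow> \<bar>\<Lambda> x\<bar> \<le> L1_norm N x"
  using assms unfolding dual_ball_def by auto

lemma real_subspace_L1:
  "real_subspace (\<lambda>c (x :: 'a \<Rightarrow> 'e::{banach, second_countable_topology}) \<omega>. c *\<^sub>R x \<omega>) (L1 N)"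
proof -
  interpret vector_space "\<lambda>c (x :: 'a \<Rightarrow> 'e) \<omega>. c *\<^sub>R x \<omega>"
    by unfold_locales (auto simp: fun_eq_iff scaleR_add_right scaleR_add_left)
  show ?thesis
    by unfold_locales (auto simp: subspace_def L1_def plus_fun_def zero_fun_def)
qed

lemma L1_convex_separation:
  fixes C :: "('a \<Rightarrow> 'e::{banach, second_countable_topology}) set"
  assumes C: "C \<subseteq> L1 N" "C \<noteq> {}"
    and conv: "\<And>a b t. a \<in> C \<Longrightarrow> b \<in> C \<Longrightarrow> 0 \<le> t \<Longrightarrow> t \<le> 1 \<Longrightarrow>
      (\<lambda>\<omega>. (1 - t) *\<^sub>R a \<omega> + t *\<^sub>R b \<omega>) \<in> C"
    and d: "\<And>c. c \<in> C \<Longrightarrow> d \<le> L1_norm N c"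
  obtains \<Lambda> where "\<Lambda> \<in> dual_ball N" "\<forall>c\<in>C. d \<le> \<Lambda> c"
proof -
  interpret real_subspace "\<lambda>c (x :: 'a \<Rightarrow> 'e) \<omega>. c *\<^sub>R x \<omega>" "L1 N"
    by (rule real_subspace_L1)
  have "seminorm (L1_norm N)"
    unfolding seminorm_def
    by (auto simp: L1_def Bochner_Integration.integral_add[symmetric]
        simp del: Bochner_Integration.integral_add intro!: integral_mono norm_triangle_ineq)
  moreover have "(\<lambda>\<omega>. (1 - t) *\<^sub>R a \<omega>) + (\<lambda>\<omega>. t *\<^sub>R b \<omega>) \<in> C"
    if "a \<in> C" "b \<in> C" "0 \<le> t" "t \<le> 1" for a b t
    using conv[OF that] by (simp add: plus_fun_def)
  ultimately obtain L where "linear_on_V L" "\<And>v. v \<in> L1 N \<Longrightarrow> \<bar>L v\<bar> \<le> L1_norm N v"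
      "\<And>c. c \<in> C \<Longrightarrow> d \<le> L c"
    using convex_separation[of "L1_norm N" C d] C d by metis
  then show ?thesis
    by (intro that[of L]) (auto simp: dual_ball_def linear_on_V_def plus_fun_def)
qed

lemma L1_norming_functional:
  assumes "z \<in> L1 N"
  obtains \<Lambda> where "\<Lambda> \<in> dual_ball N" "\<Lambda> z = L1_norm N z"
proof -
  obtain \<Lambda> where "\<Lambda> \<in> dual_ball N" "L1_norm N z \<le> \<Lambda> z"
    using L1_convex_separation[of "{z}" N "L1_norm N z"] assms
    by (auto simp: scaleR_left_distrib[symmetric])
  moreover from this have "\<bar>\<Lambda> z\<bar> \<le> L1_norm N z" using assms by (simp add: dual_ballD)
  ultimately show ?thesis by (intro that[of \<Lambda>]) auto
qed

text \<open>Convex weights living on the indices from \<open>n\<close> to \<open>q - 1\<close>; the explicit upper end keeps all sums finite.\<close>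
definition tail_weights :: "nat \<Rightarrow> nat \<Rightarrow> (nat \<Rightarrow> real) \<Rightarrow> bool" where
  "tail_weights n q w \<longleftrightarrow> (\<forall>m. 0 \<le> w m) \<and> (\<forall>m. m \<notin> {n..<q} \<longrightarrow> w m = 0) \<and> (\<Sum>m=n..<q. w m) = 1"

lemma tail_weights_sum_extend:
  fixes z :: "nat \<Rightarrow> 'e::real_vector"
  assumes "tail_weights n q w" "q \<le> q'"
  shows "(\<Sum>m=n..<q'. w m *\<^sub>R z m) = (\<Sum>m=n..<q. w m *\<^sub>R z m)"
  using assms unfolding tail_weights_def by (intro sum.mono_neutral_right) auto

lemma tail_weights_extend:
  assumes "tail_weights n q w" "q \<le> q'"
  shows "tail_weights n q' w"
  using assms tail_weights_sum_extend[OF assms, of "\<lambda>_. 1::real"] unfolding tail_weights_def by auto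

lemma tail_weights_convex:
  assumes "tail_weights n q w" "tail_weights n q w'" "0 \<le> t" "t \<le> 1"
  shows "tail_weights n q (\<lambda>m. (1 - t) * w m + t * w' m)"
  using assms unfolding tail_weights_def
  by (auto simp: sum.distrib sum_distrib_left[symmetric])

text \<open>The convex combinations of the tail form a convex set. If they all had norm at least \<open>\<epsilon>\<close>, a functional
of norm at most \<open>1\<close> would be at least \<open>\<epsilon>\<close> on the tail, contradicting weak convergence to \<open>0\<close>.\<close>
lemma mazur_L1:
  fixes z :: "nat \<Rightarrow> 'a \<Rightarrow> 'e::{banach, second_countable_topology}"
  assumes z: "\<And>m. z m \<in> L1 N"
    and weak: "\<And>\<Lambda>. \<Lambda> \<in> dual_ball N \<Longrightarrow> (\<lambda>m. \<Lambda> (z m)) \<longlonglongrightarrow> 0"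
    and \<epsilon>: "\<epsilon> > 0"
  shows "\<exists>q w. tail_weights n q w \<and> L1_norm N (\<lambda>\<omega>. \<Sum>m=n..<q. w m *\<^sub>R z m \<omega>) < \<epsilon>"
proof (rule ccontr)
  assume contr: "\<not> ?thesis"
  define C where "C = {\<lambda>\<omega>. \<Sum>m=n..<q. w m *\<^sub>R z m \<omega> | q w. tail_weights n q w}"
  have zC: "z m \<in> C" if "m \<ge> n" for m
    unfolding C_def using that
    by (auto intro!: exI[of _ "Suc m"] exI[of _ "\<lambda>k. if k = m then 1 else 0"]
        simp: tail_weights_def sum.delta if_distrib[of "\<lambda>c. c *\<^sub>R _"] cong: if_cong)
  have "C \<subseteq> L1 N" using z unfolding C_def L1_def by auto
  moreover have "C \<noteq> {}" using zC[of n] by auto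
  moreover have "(\<lambda>\<omega>. (1 - t) *\<^sub>R a \<omega> + t *\<^sub>R b \<omega>) \<in> C"
    if "a \<in> C" "b \<in> C" and t: "0 \<le> t" "t \<le> 1" for a b t
  proof -
    from that obtain q w q' w' where w: "tail_weights n q w" "tail_weights n q' w'"
      and ab: "a = (\<lambda>\<omega>. \<Sum>m=n..<q. w m *\<^sub>R z m \<omega>)" "b = (\<lambda>\<omega>. \<Sum>m=n..<q'. w' m *\<^sub>R z m \<omega>)"
      unfolding C_def mem_Collect_eq by (elim exE conjE)
    let ?q = "max q q'" and ?w = "\<lambda>m. (1 - t) * w m + t * w' m"
    have "tail_weights n ?q ?w"
      using tail_weights_extend[OF w(1), of ?q] tail_weights_extend[OF w(2), of ?q] t
      by (intro tail_weights_convex) auto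
    moreover have "(\<lambda>\<omega>. (1 - t) *\<^sub>R a \<omega> + t *\<^sub>R b \<omega>) = (\<lambda>\<omega>. \<Sum>m=n..<?q. ?w m *\<^sub>R z m \<omega>)"
    proof
      fix \<omega>
      have "a \<omega> = (\<Sum>m=n..<?q. w m *\<^sub>R z m \<omega>)" "b \<omega> = (\<Sum>m=n..<?q. w' m *\<^sub>R z m \<omega>)"
        unfolding ab using tail_weights_sum_extend[OF w(1), of ?q "\<lambda>m. z m \<omega>"]
          tail_weights_sum_extend[OF w(2), of ?q "\<lambda>m. z m \<omega>"] by auto
      then show "(1 - t) *\<^sub>R a \<omega> + t *\<^sub>R b \<omega> = (\<Sum>m=n..<?q. ?w m *\<^sub>R z m \<omega>)"
        by (simp only: scaleR_add_left sum.distrib scaleR_sum_right scaleR_scaleR)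
    qed
    ultimately show ?thesis
      unfolding C_def by (intro CollectI exI[of _ ?q] exI[of _ ?w] conjI)
  qed
  moreover have "\<epsilon> \<le> L1_norm N c" if "c \<in> C" for c using that contr unfolding C_def by force
  ultimately obtain \<Lambda> where \<Lambda>: "\<Lambda> \<in> dual_ball N" "\<forall>c\<in>C. \<epsilon> \<le> \<Lambda> c"
    by (rule L1_convex_separation)
  have "eventually (\<lambda>m. \<bar>\<Lambda> (z m)\<bar> < \<epsilon>) sequentially"
    using weak[OF \<Lambda>(1)] \<epsilon> by (auto simp: tendsto_iff)
  then obtain k where "\<And>m. m \<ge> k \<Longrightarrow> \<bar>\<Lambda> (z m)\<bar> < \<epsilon>" by (auto simp: eventually_sequentially)
  then obtain m where "m \<ge> n" "\<bar>\<Lambda> (z m)\<bar> < \<epsilon>" by (metis max.cobounded1 max.cobounded2)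
  then show False using bspec[OF \<Lambda>(2) zC, of m] by linarith
qed

text \<open>Cutoffs take the place of sets of small measure. Scaled indicators are admitted so that a set of
large or even atomic measure can still produce a function of small integral; in this way a single gliding
hump excludes both concentration on small sets and unboundedness in \<open>L\<^sub>1\<close>.\<close>
definition cutoff :: "'a measure \<Rightarrow> ('a \<Rightarrow> real) \<Rightarrow> bool" where
  "cutoff N h \<longleftrightarrow> integrable N h \<and> (\<forall>\<omega>. 0 \<le> h \<omega> \<and> h \<omega> \<le> 1)"

lemma cutoff_times_integrable:
  fixes y :: "'a \<Rightarrow> 'e::{banach, second_countable_topology}"
  assumes "cutoff N h" "integrable N y"
  shows "integrable N (\<lambda>\<omega>. h \<omega> *\<^sub>R y \<omega>)"
proof (rule Bochner_Integration.integrable_bound[OF assms(2)])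
  have [measurable]: "h \<in> borel_measurable N" "y \<in> borel_measurable N" using assms by (auto simp: cutoff_def)
  show "(\<lambda>\<omega>. h \<omega> *\<^sub>R y \<omega>) \<in> borel_measurable N" by measurable
  show "AE \<omega> in N. norm (h \<omega> *\<^sub>R y \<omega>) \<le> norm (y \<omega>)"
    using assms by (auto simp: cutoff_def intro!: mult_left_le_one_le)
qed

lemma cutoff_rest_integrable:
  fixes y :: "'a \<Rightarrow> 'e::{banach, second_countable_topology}"
  assumes "cutoff N h" "integrable N y"
  shows "integrable N (\<lambda>\<omega>. (1 - h \<omega>) *\<^sub>R y \<omega>)"
  using Bochner_Integration.integrable_diff[OF assms(2) cutoff_times_integrable[OF assms]]
  by (simp add: scaleR_diff_left)

text \<open>Absolute continuity of the integral, for cutoffs: \<open>h \<parallel>x\<parallel> \<le> k h + (\<parallel>x\<parallel> - k)\<^sup>+\<close>, and the last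
term has small integral for large \<open>k\<close>.\<close>
lemma integral_small_cutoff:
  fixes x :: "'a \<Rightarrow> 'e::{banach, second_countable_topology}"
  assumes x: "integrable N x" and \<epsilon>: "\<epsilon> > 0"
  obtains \<delta> where "\<delta> > 0"
    "\<And>h. cutoff N h \<Longrightarrow> (\<integral>\<omega>. h \<omega> \<partial>N) \<le> \<delta> \<Longrightarrow> (\<integral>\<omega>. h \<omega> * norm (x \<omega>) \<partial>N) \<le> \<epsilon>"
proof -
  have [measurable]: "x \<in> borel_measurable N" using x by auto
  have "(\<lambda>k. \<integral>\<omega>. max (norm (x \<omega>) - real k) 0 \<partial>N) \<longlonglongrightarrow> (\<integral>\<omega>. 0 \<partial>N)"
  proof (rule integral_dominated_convergence)
    show "integrable N (\<lambda>\<omega>. norm (x \<omega>))" using x by auto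
    show "AE \<omega> in N. (\<lambda>k. max (norm (x \<omega>) - real k) 0) \<longlonglongrightarrow> 0"
    proof (rule AE_I2)
      fix \<omega>
      obtain k where "norm (x \<omega>) \<le> real k" using real_arch_simple by blast
      then have "eventually (\<lambda>k. max (norm (x \<omega>) - real k) 0 = 0) sequentially"
        by (auto simp: eventually_sequentially intro!: exI[of _ k])
      then show "(\<lambda>k. max (norm (x \<omega>) - real k) 0) \<longlonglongrightarrow> 0" by (rule tendsto_eventually)
    qed
  qed auto
  then have "eventually (\<lambda>k. (\<integral>\<omega>. max (norm (x \<omega>) - real k) 0 \<partial>N) < \<epsilon> / 2) sequentially"
    using \<epsilon> by (intro order_tendstoD(2)) auto
  then obtain k where k: "(\<integral>\<omega>. max (norm (x \<omega>) - real k) 0 \<partial>N) < \<epsilon> / 2"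
    by (auto simp: eventually_sequentially)
  have mint: "integrable N (\<lambda>\<omega>. max (norm (x \<omega>) - real k) 0)"
    using x by (intro Bochner_Integration.integrable_bound[OF integrable_norm[OF x]]) auto
  show ?thesis
  proof (rule that[of "\<epsilon> / (2 * (real k + 1))"])
    show "\<epsilon> / (2 * (real k + 1)) > 0" using \<epsilon> by auto
    fix h assume h: "cutoff N h" and hs: "(\<integral>\<omega>. h \<omega> \<partial>N) \<le> \<epsilon> / (2 * (real k + 1))"
    have hi: "integrable N h" using h by (simp add: cutoff_def)
    have h01: "0 \<le> h \<omega>" "h \<omega> \<le> 1" for \<omega> using h by (auto simp: cutoff_def)
    have "(\<integral>\<omega>. h \<omega> * norm (x \<omega>) \<partial>N) \<le> (\<integral>\<omega>. real k * h \<omega> + max (norm (x \<omega>) - real k) 0 \<partial>N)"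
    proof (rule integral_mono)
      show "integrable N (\<lambda>\<omega>. h \<omega> * norm (x \<omega>))"
        using cutoff_times_integrable[OF h integrable_norm[OF x]] by simp
      show "integrable N (\<lambda>\<omega>. real k * h \<omega> + max (norm (x \<omega>) - real k) 0)" using hi mint by simp
      fix \<omega>
      have "h \<omega> * (norm (x \<omega>) - real k) \<le> h \<omega> * max (norm (x \<omega>) - real k) 0"
        using h01 by (intro mult_left_mono) auto
      also have "\<dots> \<le> max (norm (x \<omega>) - real k) 0" using h01 by (intro mult_left_le_one_le) auto
      finally show "h \<omega> * norm (x \<omega>) \<le> real k * h \<omega> + max (norm (x \<omega>) - real k) 0"
        by (simp add: algebra_simps)
    qed
    also have "\<dots> = real k * (\<integral>\<omega>. h \<omega> \<partial>N) + (\<integral>\<omega>. max (norm (x \<omega>) - real k) 0 \<partial>N)"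
      using hi mint by simp
    also have "\<dots> \<le> real k * (\<epsilon> / (2 * (real k + 1))) + \<epsilon> / 2"
      using hs k by (intro add_mono mult_left_mono) auto
    also have "\<dots> \<le> \<epsilon>" using \<epsilon> by (simp add: field_simps)
    finally show "(\<integral>\<omega>. h \<omega> * norm (x \<omega>) \<partial>N) \<le> \<epsilon>" .
  qed
qed

text \<open>\<open>\<Lambda>'\<close> arises from \<open>\<Lambda>\<close> by overwriting it, up to norm \<open>1\<close>, where a cutoff \<open>g\<close> of integral at most \<open>\<delta>\<close>
is positive. Keeping \<open>\<Lambda> ((1 - g) y)\<close> in the estimate, instead of \<open>\<Lambda> y\<close>, makes the relation compose
with a cutoff as the witness.\<close>
definition near :: "'a measure \<Rightarrow> real \<Rightarrow> (('a \<Rightarrow> 'e::{banach, second_countable_topology}) \<Rightarrow> real)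
    \<Rightarrow> (('a \<Rightarrow> 'e) \<Rightarrow> real) \<Rightarrow> bool" where
  "near N \<delta> \<Lambda> \<Lambda>' \<longleftrightarrow> (\<exists>g. cutoff N g \<and> (\<integral>\<omega>. g \<omega> \<partial>N) \<le> \<delta> \<and>
     (\<forall>y\<in>L1 N. \<bar>\<Lambda>' y - \<Lambda> (\<lambda>\<omega>. (1 - g \<omega>) *\<^sub>R y \<omega>)\<bar> \<le> (\<integral>\<omega>. g \<omega> * norm (y \<omega>) \<partial>N)))"

lemma near_mono: "near N \<delta> \<Lambda> \<Lambda>' \<Longrightarrow> \<delta> \<le> \<delta>' \<Longrightarrow> near N \<delta>' \<Lambda> \<Lambda>'"
  unfolding near_def by (meson order_trans)

lemma near_refl: "near N 0 \<Lambda> \<Lambda>"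
  unfolding near_def cutoff_def by (rule exI[of _ "\<lambda>_. 0"]) auto

text \<open>The cutoffs compose by \<open>1 - k = (1 - g) (1 - h)\<close>, which keeps \<open>k\<close> between \<open>0\<close> and \<open>1\<close> and its integral
at most the sum of the two.\<close>
lemma near_trans:
  assumes "near N \<delta> \<Lambda> \<Lambda>'" "near N \<delta>' \<Lambda>' \<Lambda>''"
  shows "near N (\<delta> + \<delta>') \<Lambda> \<Lambda>''"
proof -
  obtain g where g: "cutoff N g" "(\<integral>\<omega>. g \<omega> \<partial>N) \<le> \<delta>"
    and gy: "\<forall>y\<in>L1 N. \<bar>\<Lambda>' y - \<Lambda> (\<lambda>\<omega>. (1 - g \<omega>) *\<^sub>R y \<omega>)\<bar> \<le> (\<integral>\<omega>. g \<omega> * norm (y \<omega>) \<partial>N)"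
    using assms(1) unfolding near_def by (elim exE conjE)
  obtain h where h: "cutoff N h" "(\<integral>\<omega>. h \<omega> \<partial>N) \<le> \<delta>'"
    and hy: "\<forall>y\<in>L1 N. \<bar>\<Lambda>'' y - \<Lambda>' (\<lambda>\<omega>. (1 - h \<omega>) *\<^sub>R y \<omega>)\<bar> \<le> (\<integral>\<omega>. h \<omega> * norm (y \<omega>) \<partial>N)"
    using assms(2) unfolding near_def by (elim exE conjE)
  define k where "k \<omega> = h \<omega> + (1 - h \<omega>) * g \<omega>" for \<omega>
  have gi: "integrable N g" "\<And>\<omega>. 0 \<le> g \<omega> \<and> g \<omega> \<le> 1" and hi: "integrable N h" "\<And>\<omega>. 0 \<le> h \<omega> \<and> h \<omega> \<le> 1"
    using g h by (auto simp: cutoff_def)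
  have rg: "integrable N (\<lambda>\<omega>. (1 - h \<omega>) * g \<omega>)" using cutoff_rest_integrable[OF h(1) gi(1)] by simp
  have k1: "1 - k \<omega> = (1 - g \<omega>) * (1 - h \<omega>)" for \<omega> by (simp add: k_def algebra_simps)
  have k: "cutoff N k" unfolding cutoff_def
  proof (intro conjI allI)
    show "integrable N k" unfolding k_def[abs_def] using hi rg by simp
    fix \<omega>
    show "0 \<le> k \<omega>" using gi(2)[of \<omega>] hi(2)[of \<omega>] by (simp add: k_def)
    have "0 \<le> 1 - k \<omega>" using gi(2)[of \<omega>] hi(2)[of \<omega>] unfolding k1 by (intro mult_nonneg_nonneg) auto
    then show "k \<omega> \<le> 1" by simp
  qed
  moreover have "(\<integral>\<omega>. k \<omega> \<partial>N) \<le> \<delta> + \<delta>'"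
  proof -
    have "(\<integral>\<omega>. (1 - h \<omega>) * g \<omega> \<partial>N) \<le> (\<integral>\<omega>. g \<omega> \<partial>N)"
      using rg gi hi by (intro integral_mono) (auto intro!: mult_left_le_one_le)
    then show ?thesis unfolding k_def using hi(1) rg g(2) h(2) by simp
  qed
  moreover have "\<bar>\<Lambda>'' y - \<Lambda> (\<lambda>\<omega>. (1 - k \<omega>) *\<^sub>R y \<omega>)\<bar> \<le> (\<integral>\<omega>. k \<omega> * norm (y \<omega>) \<partial>N)"
    if y: "y \<in> L1 N" for y
  proof -
    let ?y = "\<lambda>\<omega>. (1 - h \<omega>) *\<^sub>R y \<omega>"
    have yi: "integrable N y" using y by (simp add: L1_def)
    have y': "?y \<in> L1 N" using cutoff_rest_integrable[OF h(1) yi] by (simp add: L1_def)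
    then have yi': "integrable N ?y" by (simp add: L1_def)
    have "\<bar>\<Lambda>'' y - \<Lambda> (\<lambda>\<omega>. (1 - k \<omega>) *\<^sub>R y \<omega>)\<bar> \<le>
        (\<integral>\<omega>. h \<omega> * norm (y \<omega>) \<partial>N) + (\<integral>\<omega>. g \<omega> * norm (?y \<omega>) \<partial>N)"
      using bspec[OF hy y] bspec[OF gy y'] by (simp add: k1)
    also have "\<dots> = (\<integral>\<omega>. h \<omega> * norm (y \<omega>) + g \<omega> * norm (?y \<omega>) \<partial>N)"
      using cutoff_times_integrable[OF h(1) integrable_norm[OF yi]]
        cutoff_times_integrable[OF g(1) integrable_norm[OF yi']] by simp
    also have "\<dots> = (\<integral>\<omega>. k \<omega> * norm (y \<omega>) \<partial>N)"
    proof (intro Bochner_Integration.integral_cong refl)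
      fix \<omega>
      have "norm (?y \<omega>) = (1 - h \<omega>) * norm (y \<omega>)" using hi(2)[of \<omega>] by simp
      then show "h \<omega> * norm (y \<omega>) + g \<omega> * norm (?y \<omega>) = k \<omega> * norm (y \<omega>)"
        by (simp add: k_def distrib_right mult.assoc mult.left_commute)
    qed
    finally show ?thesis .
  qed
  ultimately show ?thesis unfolding near_def by (intro exI[of _ k]) simp
qed

lemma near_difference:
  assumes "near N \<delta> \<Lambda> \<Lambda>'" "\<Lambda> \<in> dual_ball N" "y \<in> L1 N"
  obtains g where "cutoff N g" "(\<integral>\<omega>. g \<omega> \<partial>N) \<le> \<delta>"
    "\<bar>\<Lambda>' y - \<Lambda> y\<bar> \<le> 2 * (\<integral>\<omega>. g \<omega> * norm (y \<omega>) \<partial>N)"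
proof -
  obtain g where g: "cutoff N g" "(\<integral>\<omega>. g \<omega> \<partial>N) \<le> \<delta>"
    and gy: "\<forall>y\<in>L1 N. \<bar>\<Lambda>' y - \<Lambda> (\<lambda>\<omega>. (1 - g \<omega>) *\<^sub>R y \<omega>)\<bar> \<le> (\<integral>\<omega>. g \<omega> * norm (y \<omega>) \<partial>N)"
    using assms(1) unfolding near_def by (elim exE conjE)
  have yi: "integrable N y" using assms by (simp add: L1_def)
  have 1: "(\<lambda>\<omega>. (1 - g \<omega>) *\<^sub>R y \<omega>) \<in> L1 N" and 2: "(\<lambda>\<omega>. g \<omega> *\<^sub>R y \<omega>) \<in> L1 N"
    using cutoff_rest_integrable[OF g(1) yi] cutoff_times_integrable[OF g(1) yi] by (auto simp: L1_def)
  have "\<Lambda> y = \<Lambda> (\<lambda>\<omega>. (1 - g \<omega>) *\<^sub>R y \<omega>) + \<Lambda> (\<lambda>\<omega>. g \<omega> *\<^sub>R y \<omega>)"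
    using dual_ballD(1)[OF assms(2) 1 2] by (simp add: scaleR_left_distrib[symmetric])
  moreover have "\<bar>\<Lambda> (\<lambda>\<omega>. g \<omega> *\<^sub>R y \<omega>)\<bar> \<le> (\<integral>\<omega>. g \<omega> * norm (y \<omega>) \<partial>N)"
    using dual_ballD(3)[OF assms(2) 2] g(1) by (simp add: cutoff_def)
  ultimately show ?thesis using gy[rule_format, OF assms(3)] by (intro that[OF g]) linarith
qed

text \<open>One hump: \<open>\<Lambda>' y = \<Lambda> ((1 - h) y) \<plusminus> \<Theta> (h y)\<close> with \<open>\<Theta>\<close> norming \<open>h z\<close>. Since
\<open>(1 - h) + h = 1\<close> the norm stays at most \<open>1\<close>, and for one of the two signs the two values at \<open>z\<close> do not
cancel.\<close>
lemma norming_modification: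
  fixes z :: "'a \<Rightarrow> 'e::{banach, second_countable_topology}"
  assumes \<Lambda>: "\<Lambda> \<in> dual_ball N" and z: "z \<in> L1 N"
    and h: "cutoff N h" "(\<integral>\<omega>. h \<omega> \<partial>N) \<le> \<delta>"
  obtains \<Lambda>' where "\<Lambda>' \<in> dual_ball N" "near N \<delta> \<Lambda> \<Lambda>'" "(\<integral>\<omega>. h \<omega> * norm (z \<omega>) \<partial>N) \<le> \<bar>\<Lambda>' z\<bar>"
proof -
  have split: "(\<lambda>\<omega>. h \<omega> *\<^sub>R y \<omega>) \<in> L1 N" "(\<lambda>\<omega>. (1 - h \<omega>) *\<^sub>R y \<omega>) \<in> L1 N" if "y \<in> L1 N" for y :: "'a \<Rightarrow> 'e"
    using cutoff_rest_integrable[OF h(1)] cutoff_times_integrable[OF h(1)] that by (auto simp: L1_def)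
  have h01: "0 \<le> h \<omega>" "h \<omega> \<le> 1" for \<omega> using h(1) by (auto simp: cutoff_def)
  obtain \<Theta> where \<Theta>: "\<Theta> \<in> dual_ball N"
    and \<Theta>z: "\<Theta> (\<lambda>\<omega>. h \<omega> *\<^sub>R z \<omega>) = (\<integral>\<omega>. h \<omega> * norm (z \<omega>) \<partial>N)"
    using L1_norming_functional[OF split(1)[OF z]] h01 by auto
  define \<Lambda>s where "\<Lambda>s s y = \<Lambda> (\<lambda>\<omega>. (1 - h \<omega>) *\<^sub>R y \<omega>) + s * \<Theta> (\<lambda>\<omega>. h \<omega> *\<^sub>R y \<omega>)" for s :: real and y
  have norm_h: "\<bar>\<Theta> (\<lambda>\<omega>. h \<omega> *\<^sub>R y \<omega>)\<bar> \<le> (\<integral>\<omega>. h \<omega> * norm (y \<omega>) \<partial>N)" if "y \<in> L1 N" for y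
    using dual_ballD(3)[OF \<Theta> split(1)[OF that]] h01 by simp
  have ball: "\<Lambda>s s \<in> dual_ball N" if s: "\<bar>s\<bar> = 1" for s
    unfolding dual_ball_def
  proof (safe)
    fix x y :: "'a \<Rightarrow> 'e" assume xy: "x \<in> L1 N" "y \<in> L1 N"
    show "\<Lambda>s s (\<lambda>\<omega>. x \<omega> + y \<omega>) = \<Lambda>s s x + \<Lambda>s s y"
      unfolding \<Lambda>s_def
      using dual_ballD(1)[OF \<Lambda> split(2)[OF xy(1)] split(2)[OF xy(2)]]
        dual_ballD(1)[OF \<Theta> split(1)[OF xy(1)] split(1)[OF xy(2)]]
      by (simp only: scaleR_add_right distrib_left)
  next
    fix x :: "'a \<Rightarrow> 'e" and c :: real assume x: "x \<in> L1 N"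
    have "(\<lambda>\<omega>. a \<omega> *\<^sub>R c *\<^sub>R x \<omega>) = (\<lambda>\<omega>. c *\<^sub>R a \<omega> *\<^sub>R x \<omega>)" for a :: "'a \<Rightarrow> real"
      by (simp add: mult.commute)
    then show "\<Lambda>s s (\<lambda>\<omega>. c *\<^sub>R x \<omega>) = c * \<Lambda>s s x"
      unfolding \<Lambda>s_def using dual_ballD(2)[OF \<Lambda> split(2)[OF x], of c] dual_ballD(2)[OF \<Theta> split(1)[OF x], of c]
      by (simp only: distrib_left mult.left_commute)
  next
    fix x :: "'a \<Rightarrow> 'e" assume x: "x \<in> L1 N"
    then have xi: "integrable N x" by (simp add: L1_def)
    have "\<bar>\<Lambda>s s x\<bar> \<le> \<bar>\<Lambda> (\<lambda>\<omega>. (1 - h \<omega>) *\<^sub>R x \<omega>)\<bar> + \<bar>s\<bar> * \<bar>\<Theta> (\<lambda>\<omega>. h \<omega> *\<^sub>R x \<omega>)\<bar>"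
      unfolding \<Lambda>s_def by (metis abs_mult abs_triangle_ineq)
    also have "\<dots> \<le> (\<integral>\<omega>. (1 - h \<omega>) * norm (x \<omega>) \<partial>N) + (\<integral>\<omega>. h \<omega> * norm (x \<omega>) \<partial>N)"
      using dual_ballD(3)[OF \<Lambda> split(2)[OF x]] norm_h[OF x] s h01 by simp
    also have "\<dots> = (\<integral>\<omega>. (1 - h \<omega>) * norm (x \<omega>) + h \<omega> * norm (x \<omega>) \<partial>N)"
      using cutoff_rest_integrable[OF h(1) integrable_norm[OF xi]]
        cutoff_times_integrable[OF h(1) integrable_norm[OF xi]] by simp
    also have "\<dots> = L1_norm N x" by (simp add: algebra_simps)
    finally show "\<bar>\<Lambda>s s x\<bar> \<le> L1_norm N x" .
  qed
  have near: "near N \<delta> \<Lambda> (\<Lambda>s s)" if "\<bar>s\<bar> = 1" for s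
    unfolding near_def \<Lambda>s_def using h norm_h that by (intro exI[of _ h]) (simp add: abs_mult)
  let ?b = "\<Lambda> (\<lambda>\<omega>. (1 - h \<omega>) *\<^sub>R z \<omega>)" and ?a = "\<integral>\<omega>. h \<omega> * norm (z \<omega>) \<partial>N"
  have "?a \<le> \<bar>\<Lambda>s 1 z\<bar> \<or> ?a \<le> \<bar>\<Lambda>s (-1) z\<bar>" unfolding \<Lambda>s_def \<Theta>z by linarith
  then show ?thesis using that ball near by (metis abs_1 abs_minus_cancel)
qed

text \<open>Gliding hump. Otherwise choose recursively indices \<open>m i\<close>, cutoffs and functionals \<open>\<Lambda> i\<close> with
\<open>\<bar>\<Lambda> i (z (m i))\<bar> \<ge> \<epsilon>\<close>, each \<open>\<Lambda> (Suc i)\<close> overwriting \<open>\<Lambda> i\<close> on a cutoff so small that the value at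
\<open>z (m i)\<close> changes by at most \<open>\<epsilon> / 4\<close> in all later steps together. The \<open>\<Lambda> i\<close> converge pointwise, and
their limit does not tend to \<open>0\<close> along \<open>z\<close>.\<close>
lemma weakly_null_L1_equicontinuous:
  fixes z :: "nat \<Rightarrow> 'a \<Rightarrow> 'e::{banach, second_countable_topology}"
  assumes z: "\<And>m. z m \<in> L1 N"
    and weak: "\<And>\<Lambda>. \<Lambda> \<in> dual_ball N \<Longrightarrow> (\<lambda>m. \<Lambda> (z m)) \<longlonglongrightarrow> 0"
    and \<epsilon>: "\<epsilon> > 0"
  obtains \<delta> n where "\<delta> > 0" "\<And>m h. m \<ge> n \<Longrightarrow> cutoff N h \<Longrightarrow> (\<integral>\<omega>. h \<omega> \<partial>N) \<le> \<delta> \<Longrightarrow>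
    (\<integral>\<omega>. h \<omega> * norm (z m \<omega>) \<partial>N) \<le> \<epsilon>"
proof (rule ccontr)
  note outer = that
  assume no: "\<not> thesis"
  have contr: "\<exists>m\<ge>n. \<exists>h. cutoff N h \<and> (\<integral>\<omega>. h \<omega> \<partial>N) \<le> \<delta> \<and> \<epsilon> < (\<integral>\<omega>. h \<omega> * norm (z m \<omega>) \<partial>N)"
    if \<delta>: "\<delta> > 0" for \<delta> n
  proof (rule ccontr)
    assume "\<not> ?thesis"
    then show False using no outer[OF \<delta>, of n] by (meson not_less)
  qed
  define P where "P = (\<lambda>(\<Lambda>, \<delta>, m). \<Lambda> \<in> dual_ball N \<and> 0 < \<delta> \<and> \<epsilon> \<le> \<bar>\<Lambda> (z m)\<bar> \<and>
    (\<forall>h. cutoff N h \<longrightarrow> (\<integral>\<omega>. h \<omega> \<partial>N) \<le> \<delta> \<longrightarrow> (\<integral>\<omega>. h \<omega> * norm (z m \<omega>) \<partial>N) \<le> \<epsilon> / 8))"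
  have step: "\<exists>\<Lambda>' \<delta>' m. P (\<Lambda>', \<delta>', m) \<and> near N (\<delta> / 2) \<Lambda> \<Lambda>' \<and> \<delta>' \<le> \<delta> / 2 \<and> n \<le> m"
    if \<Lambda>: "\<Lambda> \<in> dual_ball N" and \<delta>: "\<delta> > 0" for \<Lambda> \<delta> n
  proof -
    obtain m h where m: "m \<ge> n" and h: "cutoff N h" "(\<integral>\<omega>. h \<omega> \<partial>N) \<le> \<delta> / 2"
      and big: "\<epsilon> < (\<integral>\<omega>. h \<omega> * norm (z m \<omega>) \<partial>N)"
      using contr[of "\<delta> / 2" n] \<delta> by auto
    obtain \<Lambda>' where \<Lambda>': "\<Lambda>' \<in> dual_ball N" "near N (\<delta> / 2) \<Lambda> \<Lambda>'" "(\<integral>\<omega>. h \<omega> * norm (z m \<omega>) \<partial>N) \<le> \<bar>\<Lambda>' (z m)\<bar>"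
      using norming_modification[OF \<Lambda> z h] by blast
    have "integrable N (z m)" using z by (auto simp: L1_def)
    then obtain \<eta> where \<eta>: "\<eta> > 0"
      "\<And>h. cutoff N h \<Longrightarrow> (\<integral>\<omega>. h \<omega> \<partial>N) \<le> \<eta> \<Longrightarrow> (\<integral>\<omega>. h \<omega> * norm (z m \<omega>) \<partial>N) \<le> \<epsilon> / 8"
      using integral_small_cutoff[of N "z m" "\<epsilon> / 8"] \<epsilon> by auto
    have "P (\<Lambda>', min \<eta> (\<delta> / 2), m)" using \<Lambda>' big \<eta> \<delta> by (auto simp: P_def)
    then show ?thesis using \<Lambda>' m by (intro exI[of _ \<Lambda>'] exI[of _ "min \<eta> (\<delta> / 2)"] exI[of _ m]) auto
  qed
  have zero: "(\<lambda>_. 0) \<in> dual_ball N" by (auto simp: dual_ball_def)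
  define Q where "Q = (\<lambda>(\<Lambda> :: ('a \<Rightarrow> 'e) \<Rightarrow> real, \<delta>, m :: nat) (\<Lambda>', \<delta>', m'). near N (\<delta> / 2) \<Lambda> \<Lambda>' \<and> \<delta>' \<le> \<delta> / 2 \<and> m < m')"
  have "\<exists>s. \<forall>i. P (s i) \<and> Q (s i) (s (Suc i))"
  proof (rule dependent_nat_choice)
    show "\<exists>s. P s" using step[OF zero, of 1 0] by auto
    fix s and i :: nat assume "P s"
    moreover obtain \<Lambda> \<delta> m where s: "s = (\<Lambda>, \<delta>, m)" by (cases s) auto
    ultimately obtain \<Lambda>' \<delta>' m' where "P (\<Lambda>', \<delta>', m')" "near N (\<delta> / 2) \<Lambda> \<Lambda>'" "\<delta>' \<le> \<delta> / 2" "Suc m \<le> m'"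
      using step[of \<Lambda> \<delta> "Suc m"] unfolding P_def prod.case by blast
    then show "\<exists>t. P t \<and> Q s t"
      by (intro exI[of _ "(\<Lambda>', \<delta>', m')"]) (simp add: s Q_def)
  qed
  then obtain s where s: "\<And>i. P (s i)" "\<And>i. Q (s i) (s (Suc i))" by blast
  define \<Lambda> \<delta> m where "\<Lambda> i = fst (s i)" and "\<delta> i = fst (snd (s i))" and "m i = snd (snd (s i))" for i
  have ball: "\<Lambda> i \<in> dual_ball N" and \<delta>0: "0 < \<delta> i" and big: "\<epsilon> \<le> \<bar>\<Lambda> i (z (m i))\<bar>"
    and small: "cutoff N h \<Longrightarrow> (\<integral>\<omega>. h \<omega> \<partial>N) \<le> \<delta> i \<Longrightarrow> (\<integral>\<omega>. h \<omega> * norm (z (m i) \<omega>) \<partial>N) \<le> \<epsilon> / 8" for i h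
    using s(1)[of i] by (auto simp: P_def \<Lambda>_def \<delta>_def m_def split: prod.splits)
  have near1: "near N (\<delta> i / 2) (\<Lambda> i) (\<Lambda> (Suc i))" and \<delta>half: "\<delta> (Suc i) \<le> \<delta> i / 2" and mSuc: "m i < m (Suc i)" for i
    using s(2)[of i] by (auto simp: Q_def \<Lambda>_def \<delta>_def m_def split: prod.splits)
  have mm: "strict_mono m" using mSuc by (simp add: strict_mono_Suc_iff)
  \<comment> \<open>Telescoping: halving gives \<open>\<delta> j / 2 \<le> \<delta> j - \<delta> (Suc j)\<close>, so all steps after \<open>i\<close> together cost at most \<open>\<delta> i\<close>.\<close>
  have "near N (\<delta> i - \<delta> j) (\<Lambda> i) (\<Lambda> j)" if "i \<le> j" for i j using that
  proof (induction j rule: dec_induct)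
    case base
    then show ?case using near_refl by simp
  next
    case (step j)
    show ?case by (rule near_mono[OF near_trans[OF step.IH near1]]) (use \<delta>half[of j] in simp)
  qed
  then have nearij: "near N (\<delta> i) (\<Lambda> i) (\<Lambda> j)" if "i \<le> j" for i j
    by (rule near_mono) (use that \<delta>0[of j] in auto)
  have \<delta>_le: "\<delta> i \<le> \<delta> 0 * (1/2) ^ i" for i
  proof (induction i)
    case (Suc i)
    then show ?case using \<delta>half[of i] by simp
  qed simp
  have "(\<lambda>i. \<delta> 0 * (1/2) ^ i) \<longlonglongrightarrow> \<delta> 0 * 0"
    by (intro tendsto_intros LIMSEQ_power_zero) auto
  then have \<delta>lim: "\<delta> \<longlonglongrightarrow> 0"
    using tendsto_sandwich[of "\<lambda>_. 0" \<delta> sequentially "\<lambda>i. \<delta> 0 * (1/2) ^ i" 0] \<delta>_le \<delta>0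
    by (simp add: less_imp_le)
  have conv: "convergent (\<lambda>i. \<Lambda> i y)" if y: "y \<in> L1 N" for y
  proof (rule Cauchy_convergent, rule metric_CauchyI)
    fix e :: real assume e: "e > 0"
    have "integrable N y" using y by (simp add: L1_def)
    then obtain \<eta> where \<eta>: "\<eta> > 0"
      "\<And>h. cutoff N h \<Longrightarrow> (\<integral>\<omega>. h \<omega> \<partial>N) \<le> \<eta> \<Longrightarrow> (\<integral>\<omega>. h \<omega> * norm (y \<omega>) \<partial>N) \<le> e / 5"
      using integral_small_cutoff[of N y "e / 5"] e by auto
    obtain i where i: "\<delta> i < \<eta>"
      using order_tendstoD(2)[OF \<delta>lim \<eta>(1)] by (auto simp: eventually_sequentially)
    have *: "\<bar>\<Lambda> j y - \<Lambda> i y\<bar> \<le> 2 * (e / 5)" if ij: "i \<le> j" for j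
    proof -
      obtain g where "cutoff N g" "(\<integral>\<omega>. g \<omega> \<partial>N) \<le> \<delta> i"
        "\<bar>\<Lambda> j y - \<Lambda> i y\<bar> \<le> 2 * (\<integral>\<omega>. g \<omega> * norm (y \<omega>) \<partial>N)"
        using near_difference[OF nearij[OF ij] ball y] by blast
      then show ?thesis using \<eta>(2)[of g] i by linarith
    qed
    show "\<exists>M. \<forall>j\<ge>M. \<forall>k\<ge>M. dist (\<Lambda> j y) (\<Lambda> k y) < e"
    proof (intro exI allI impI)
      fix j k assume "i \<le> j" "i \<le> k"
      then show "dist (\<Lambda> j y) (\<Lambda> k y) < e" using *[of j] *[of k] e unfolding dist_real_def by linarith
    qed
  qed
  define L where "L y = lim (\<lambda>i. \<Lambda> i y)" for y
  have L: "(\<lambda>i. \<Lambda> i y) \<longlonglongrightarrow> L y" if "y \<in> L1 N" for y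
    using conv[OF that] by (simp add: L_def convergent_LIMSEQ_iff)
  have "L \<in> dual_ball N" unfolding dual_ball_def
  proof safe
    fix x y :: "'a \<Rightarrow> 'e" assume xy: "x \<in> L1 N" "y \<in> L1 N"
    have "(\<lambda>\<omega>. x \<omega> + y \<omega>) \<in> L1 N" using xy by (simp add: L1_def)
    then have "(\<lambda>i. \<Lambda> i (\<lambda>\<omega>. x \<omega> + y \<omega>)) \<longlonglongrightarrow> L (\<lambda>\<omega>. x \<omega> + y \<omega>)" by (rule L)
    moreover have "(\<lambda>i. \<Lambda> i (\<lambda>\<omega>. x \<omega> + y \<omega>)) \<longlonglongrightarrow> L x + L y"
      using tendsto_add[OF L[OF xy(1)] L[OF xy(2)]] dual_ballD(1)[OF ball xy] by simp
    ultimately show "L (\<lambda>\<omega>. x \<omega> + y \<omega>) = L x + L y" by (rule LIMSEQ_unique)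
  next
    fix x :: "'a \<Rightarrow> 'e" and c :: real assume x: "x \<in> L1 N"
    have "(\<lambda>\<omega>. c *\<^sub>R x \<omega>) \<in> L1 N" using x by (simp add: L1_def)
    then have "(\<lambda>i. \<Lambda> i (\<lambda>\<omega>. c *\<^sub>R x \<omega>)) \<longlonglongrightarrow> L (\<lambda>\<omega>. c *\<^sub>R x \<omega>)" by (rule L)
    moreover have "(\<lambda>i. \<Lambda> i (\<lambda>\<omega>. c *\<^sub>R x \<omega>)) \<longlonglongrightarrow> c * L x"
      using tendsto_mult_left[OF L[OF x], of c] dual_ballD(2)[OF ball x] by simp
    ultimately show "L (\<lambda>\<omega>. c *\<^sub>R x \<omega>) = c * L x" by (rule LIMSEQ_unique)
  next
    fix x :: "'a \<Rightarrow> 'e" assume x: "x \<in> L1 N"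
    show "\<bar>L x\<bar> \<le> L1_norm N x"
      using tendsto_rabs[OF L[OF x]] by (rule LIMSEQ_le_const2) (use dual_ballD(3)[OF ball x] in auto)
  qed
  then have "(\<lambda>k. L (z k)) \<longlonglongrightarrow> 0" by (rule weak)
  then have "(\<lambda>i. L (z (m i))) \<longlonglongrightarrow> 0" using LIMSEQ_subseq_LIMSEQ[OF _ mm] by (force simp: o_def)
  then have "eventually (\<lambda>i. \<bar>L (z (m i))\<bar> < \<epsilon> / 2) sequentially"
    using \<epsilon> by (intro order_tendstoD(2)[OF tendsto_rabs_zero]) auto
  then obtain i where i: "\<bar>L (z (m i))\<bar> < \<epsilon> / 2" by (auto simp: eventually_sequentially)
  have "\<bar>\<Lambda> i (z (m i))\<bar> - \<epsilon> / 4 \<le> \<bar>\<Lambda> j (z (m i))\<bar>" if ij: "i \<le> j" for j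
  proof -
    obtain g where "cutoff N g" "(\<integral>\<omega>. g \<omega> \<partial>N) \<le> \<delta> i"
      "\<bar>\<Lambda> j (z (m i)) - \<Lambda> i (z (m i))\<bar> \<le> 2 * (\<integral>\<omega>. g \<omega> * norm (z (m i) \<omega>) \<partial>N)"
      using near_difference[OF nearij[OF ij] ball z[of "m i"]] by blast
    then show ?thesis using small[of g i] by linarith
  qed
  then have "\<bar>\<Lambda> i (z (m i))\<bar> - \<epsilon> / 4 \<le> \<bar>L (z (m i))\<bar>"
    using tendsto_rabs[OF L[OF z[of "m i"]]] by (intro LIMSEQ_le_const) auto
  then show False using big[of i] i \<epsilon> by linarith
qed

text \<open>If the integral \<open>S\<close> of \<open>\<parallel>x\<^sub>m\<parallel>\<close> over \<open>{\<parallel>x\<^sub>m\<parallel> > R}\<close> exceeds \<open>\<epsilon>\<close>, the indicator of this set scaled by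
\<open>\<epsilon> / S\<close> is a cutoff of integral at most \<open>\<epsilon> / R\<close> against which \<open>\<parallel>x\<^sub>m\<parallel>\<close> has integral \<open>\<epsilon>\<close>. For large \<open>R\<close>
this contradicts the previous lemma, applied to \<open>x\<^sub>m - x\<close>.\<close>
lemma weakly_convergent_L1_uniformly_integrable:
  fixes xs :: "nat \<Rightarrow> 'a \<Rightarrow> 'e::{banach, second_countable_topology}"
  assumes xs: "\<And>m. xs m \<in> L1 N" and x: "x \<in> L1 N"
    and weak: "\<And>\<Lambda>. \<Lambda> \<in> dual_ball N \<Longrightarrow> (\<lambda>m. \<Lambda> (xs m)) \<longlonglongrightarrow> \<Lambda> x"
    and \<epsilon>: "\<epsilon> > 0"
  obtains R n where "R > 0" "\<And>m. m \<ge> n \<Longrightarrow> (\<integral>\<omega>. (if norm (xs m \<omega>) > R then norm (xs m \<omega>) else 0) \<partial>N) \<le> \<epsilon>"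
proof -
  define z where "z m \<omega> = xs m \<omega> - x \<omega>" for m \<omega>
  have xi: "integrable N x" and xsi: "integrable N (xs m)" for m using xs x by (auto simp: L1_def)
  then have zi: "integrable N (z m)" for m unfolding z_def[abs_def] by auto
  have zL: "z m \<in> L1 N" for m using zi by (auto simp: L1_def)
  have "(\<lambda>m. \<Lambda> (z m)) \<longlonglongrightarrow> 0" if \<Lambda>: "\<Lambda> \<in> dual_ball N" for \<Lambda>
  proof -
    have "\<Lambda> (z m) = \<Lambda> (xs m) - \<Lambda> x" for m
      using dual_ballD(1)[OF \<Lambda> zL x, of m] by (simp add: z_def)
    then show ?thesis using tendsto_diff[OF weak[OF \<Lambda>] tendsto_const[of "\<Lambda> x"]] by simp
  qed
  then obtain \<delta> n where \<delta>: "\<delta> > 0" and zsmall: "\<And>m h. m \<ge> n \<Longrightarrow> cutoff N h \<Longrightarrow> (\<integral>\<omega>. h \<omega> \<partial>N) \<le> \<delta> \<Longrightarrow>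
      (\<integral>\<omega>. h \<omega> * norm (z m \<omega>) \<partial>N) \<le> \<epsilon> / 4"
    using weakly_null_L1_equicontinuous[of z N "\<epsilon> / 4"] zL \<epsilon> by auto
  obtain \<delta>' where \<delta>': "\<delta>' > 0" and xsmall: "\<And>h. cutoff N h \<Longrightarrow> (\<integral>\<omega>. h \<omega> \<partial>N) \<le> \<delta>' \<Longrightarrow>
      (\<integral>\<omega>. h \<omega> * norm (x \<omega>) \<partial>N) \<le> \<epsilon> / 4"
    using integral_small_cutoff[OF xi, of "\<epsilon> / 4"] \<epsilon> by auto
  define R where "R = \<epsilon> / min \<delta> \<delta>'"
  have R: "R > 0" using \<delta> \<delta>' \<epsilon> by (auto simp: R_def)
  show ?thesis
  proof (rule that[OF R], rule ccontr)
    fix m assume m: "m \<ge> n"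
    define b where "b \<omega> = (if norm (xs m \<omega>) > R then norm (xs m \<omega>) else 0)" for \<omega>
    define S where "S = (\<integral>\<omega>. b \<omega> \<partial>N)"
    assume "\<not> (\<integral>\<omega>. (if norm (xs m \<omega>) > R then norm (xs m \<omega>) else 0) \<partial>N) \<le> \<epsilon>"
    then have S: "S > \<epsilon>" by (simp add: S_def b_def)
    have [measurable]: "xs m \<in> borel_measurable N" using xsi by auto
    have bi: "integrable N b" unfolding b_def[abs_def]
      by (rule Bochner_Integration.integrable_bound[OF integrable_norm[OF xsi[of m]]]) auto
    define h where "h \<omega> = (if norm (xs m \<omega>) > R then \<epsilon> / S else 0)" for \<omega>
    have hb: "h \<omega> \<le> (\<epsilon> / S / R) * b \<omega>" and h0: "h \<omega> \<ge> 0" for \<omega>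
      using S \<epsilon> R by (auto simp: h_def b_def field_simps)
    have hi: "integrable N h"
    proof (rule Bochner_Integration.integrable_bound)
      show "integrable N (\<lambda>\<omega>. (\<epsilon> / S / R) * b \<omega>)" using bi by simp
      show "AE \<omega> in N. norm (h \<omega>) \<le> norm ((\<epsilon> / S / R) * b \<omega>)"
        using hb h0 by (intro AE_I2) (metis abs_ge_self abs_of_nonneg order_trans real_norm_def)
    qed (simp add: h_def[abs_def])
    have h: "cutoff N h" using hi S \<epsilon> by (auto simp: cutoff_def h_def)
    have "(\<integral>\<omega>. h \<omega> \<partial>N) \<le> (\<integral>\<omega>. (\<epsilon> / S / R) * b \<omega> \<partial>N)"
      using hi bi hb by (intro integral_mono) auto
    also have "\<dots> = \<epsilon> / R" using S \<epsilon> by (simp add: S_def[symmetric])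
    also have "\<dots> = min \<delta> \<delta>'" using \<epsilon> by (simp add: R_def)
    finally have hs: "(\<integral>\<omega>. h \<omega> \<partial>N) \<le> \<delta>" "(\<integral>\<omega>. h \<omega> \<partial>N) \<le> \<delta>'" by auto
    have "\<epsilon> = (\<integral>\<omega>. (\<epsilon> / S) * b \<omega> \<partial>N)" using S \<epsilon> by (simp add: S_def[symmetric])
    also have "\<dots> = (\<integral>\<omega>. h \<omega> * norm (xs m \<omega>) \<partial>N)"
      by (intro Bochner_Integration.integral_cong) (auto simp: h_def b_def)
    also have "\<dots> \<le> (\<integral>\<omega>. h \<omega> * norm (z m \<omega>) + h \<omega> * norm (x \<omega>) \<partial>N)"
    proof (rule integral_mono)
      show "integrable N (\<lambda>\<omega>. h \<omega> * norm (xs m \<omega>))"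
        "integrable N (\<lambda>\<omega>. h \<omega> * norm (z m \<omega>) + h \<omega> * norm (x \<omega>))"
        using cutoff_times_integrable[OF h integrable_norm[OF zi[of m]]]
          cutoff_times_integrable[OF h integrable_norm[OF xi]]
          cutoff_times_integrable[OF h integrable_norm[OF xsi[of m]]] by auto
      fix \<omega>
      have "norm (xs m \<omega>) \<le> norm (z m \<omega>) + norm (x \<omega>)"
        unfolding z_def by (metis diff_add_cancel norm_triangle_ineq)
      then show "h \<omega> * norm (xs m \<omega>) \<le> h \<omega> * norm (z m \<omega>) + h \<omega> * norm (x \<omega>)"
        using h0[of \<omega>] by (metis distrib_left mult_left_mono)
    qed
    also have "\<dots> = (\<integral>\<omega>. h \<omega> * norm (z m \<omega>) \<partial>N) + (\<integral>\<omega>. h \<omega> * norm (x \<omega>) \<partial>N)"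
      using cutoff_times_integrable[OF h integrable_norm[OF zi[of m]]]
          cutoff_times_integrable[OF h integrable_norm[OF xi]] by simp
    also have "\<dots> \<le> \<epsilon> / 4 + \<epsilon> / 4" using zsmall[OF m h hs(1)] xsmall[OF h hs(2)] by simp
    finally show False using \<epsilon> by simp
  qed
qed


section \<open>Weak sequential compactness and the pointwise inequality\<close>

lemma limitin_initial_topology_imp:
  assumes lim: "limitin (initial_topology V D) xs x sequentially" and \<phi>: "\<phi> \<in> D"
  shows "x \<in> V" and "(\<lambda>n. \<phi> (xs n)) \<longlonglongrightarrow> \<phi> x"
proof -
  have "x \<in> topspace (initial_topology V D)" using lim by (simp add: limitin_def)
  then show xV: "x \<in> V" unfolding initial_topology_def topology_generated_by_topspace by auto
  show "(\<lambda>n. \<phi> (xs n)) \<longlonglongrightarrow> \<phi> x"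
  proof (rule topological_tendstoI)
    fix U :: "real set" assume U: "open U" "\<phi> x \<in> U"
    have "openin (initial_topology V D) {v \<in> V. \<phi> v \<in> U}"
      unfolding initial_topology_def openin_topology_generated_by_iff
      using \<phi> U by (intro generate_topology_on.Basis) auto
    then have "eventually (\<lambda>n. xs n \<in> {v \<in> V. \<phi> v \<in> U}) sequentially"
      using lim xV U by (auto simp: limitin_def)
    then show "eventually (\<lambda>n. \<phi> (xs n) \<in> U) sequentially" by eventually_elim auto
  qed
qed

lemma topspace_weak_topology: "topspace (weak_topology :: 'e::real_normed_vector topology) = UNIV"
proof -
  have "(UNIV :: 'e set) \<in> {{v \<in> UNIV. \<phi> v \<in> U} | \<phi> U.
      \<phi> \<in> range (blinfun_apply :: ('e \<Rightarrow>\<^sub>L real) \<Rightarrow> 'e \<Rightarrow> real) \<and> open U}"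
    by (auto intro!: exI[of _ UNIV])
  then show ?thesis
    unfolding weak_topology_def initial_topology_def topology_generated_by_topspace by blast
qed

lemma limitin_weak_topologyI:
  fixes e :: "'e::real_normed_vector"
  assumes "\<And>\<phi> :: 'e \<Rightarrow>\<^sub>L real. (\<lambda>n. blinfun_apply \<phi> (es n)) \<longlonglongrightarrow> blinfun_apply \<phi> e"
  shows "limitin weak_topology es e sequentially"
proof -
  have "eventually (\<lambda>n. es n \<in> U) sequentially"
    if "generate_topology_on {{v \<in> UNIV. \<phi> v \<in> U} | \<phi> U.
      \<phi> \<in> range (blinfun_apply :: ('e \<Rightarrow>\<^sub>L real) \<Rightarrow> 'e \<Rightarrow> real) \<and> open U} U" "e \<in> U" for U
    using that
  proof (induction)
    case (Int a b)
    then show ?case by (auto intro: eventually_conj)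
  next
    case (UN K)
    then obtain k where k: "k \<in> K" "e \<in> k" by blast
    then have "eventually (\<lambda>n. es n \<in> k) sequentially" using UN by blast
    then show ?case by eventually_elim (use k in blast)
  next
    case (Basis s)
    then obtain \<phi> :: "'e \<Rightarrow>\<^sub>L real" and W where s: "s = {v. blinfun_apply \<phi> v \<in> W}" "open W" by auto
    then show ?case using topological_tendstoD[OF assms[of \<phi>], of W] Basis by simp
  qed auto
  then show ?thesis
    unfolding limitin_def topspace_weak_topology
    by (auto simp: weak_topology_def initial_topology_def openin_topology_generated_by_iff)
qed

lemma normed_convex_separation:
  fixes C :: "'v::real_normed_vector set"
  assumes C: "C \<noteq> {}" "convex C" and d: "\<And>c. c \<in> C \<Longrightarrow> d \<le> norm c"
  obtains \<phi> :: "'v \<Rightarrow>\<^sub>L real" where "norm \<phi> \<le> 1" "\<forall>c\<in>C. d \<le> blinfun_apply \<phi> c"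
proof -
  interpret real_subspace "scaleR :: real \<Rightarrow> 'v \<Rightarrow> 'v" UNIV
    by unfold_locales (auto simp: scaleR_add_left scaleR_add_right Modules.module.subspace_def[OF real_vector.module_axioms])
  have "seminorm norm" by (auto simp: seminorm_def norm_triangle_ineq)
  then obtain L where L: "linear_on_V L" "\<And>v. \<bar>L v\<bar> \<le> norm v" "\<And>c. c \<in> C \<Longrightarrow> d \<le> L c"
    using convex_separation[of norm C d] C d convexD_alt[OF C(2)] by (metis UNIV_I subset_UNIV)
  have bl: "bounded_linear L"
    using L(1,2) by (intro bounded_linear_intro[of _ 1]) (auto simp: linear_on_V_def)
  show ?thesis
  proof (rule that[of "Blinfun L"])
    show "norm (Blinfun L) \<le> 1"
      using L(2) by (intro norm_blinfun_bound) (auto simp: bounded_linear_Blinfun_apply[OF bl])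
  qed (use L(3) in \<open>simp add: bounded_linear_Blinfun_apply[OF bl]\<close>)
qed

lemma normed_norming_functional:
  fixes e :: "'v::real_normed_vector"
  obtains \<phi> :: "'v \<Rightarrow>\<^sub>L real" where "norm \<phi> \<le> 1" "blinfun_apply \<phi> e = norm e"
proof -
  obtain \<phi> :: "'v \<Rightarrow>\<^sub>L real" where \<phi>: "norm \<phi> \<le> 1" "norm e \<le> blinfun_apply \<phi> e"
    using normed_convex_separation[of "{e}" "norm e"] by auto
  have "blinfun_apply \<phi> e \<le> norm \<phi> * norm e" using norm_blinfun[of \<phi> e] by auto
  also have "\<dots> \<le> norm e" using \<phi>(1) by (simp add: mult_left_le_one_le)
  finally show ?thesis using \<phi> by (intro that[of \<phi>]) auto
qed

text \<open>Norming functionals of a dense sequence \<open>d n\<close> of the space span a dense subspace of the dual. Otherwise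
separation gives a bounded functional on the dual, by reflexivity evaluation at some \<open>e \<noteq> 0\<close>, that
vanishes at all \<open>\<phi> n\<close>; a point \<open>d n\<close> close to \<open>e\<close> then has
\<open>\<parallel>d n\<parallel> = \<phi> n (d n - e) \<le> \<parallel>d n - e\<parallel>\<close>, which is too small.\<close>
lemma reflexive_dual_separable:
  assumes reflexive: "reflexive_space TYPE('e::{banach, second_countable_topology})"
  obtains \<phi> :: "nat \<Rightarrow> 'e::{banach, second_countable_topology} \<Rightarrow>\<^sub>L real" where "\<And>n. norm (\<phi> n) \<le> 1"
    "\<And>\<psi> \<epsilon>. \<epsilon> > 0 \<Longrightarrow> \<exists>\<eta>\<in>span (range \<phi>). norm (\<psi> - \<eta>) < \<epsilon>"
proof -
  obtain D :: "'e set" where D: "countable D" "\<And>X. open X \<Longrightarrow> X \<noteq> {} \<Longrightarrow> \<exists>d\<in>D. d \<in> X"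
    using countable_dense_exists by blast
  have Dne: "D \<noteq> {}" using D(2)[of UNIV] by auto
  define d where "d = from_nat_into D"
  have "\<exists>\<phi> :: 'e \<Rightarrow>\<^sub>L real. norm \<phi> \<le> 1 \<and> blinfun_apply \<phi> (d n) = norm (d n)" for n
    using normed_norming_functional[of "d n"] by blast
  then obtain \<phi> :: "nat \<Rightarrow> 'e \<Rightarrow>\<^sub>L real" where \<phi>: "\<And>n. norm (\<phi> n) \<le> 1" "\<And>n. blinfun_apply (\<phi> n) (d n) = norm (d n)"
    by metis
  show ?thesis
  proof (rule that[of \<phi>, OF \<phi>(1)], rule ccontr)
    fix \<psi> :: "'e \<Rightarrow>\<^sub>L real" and \<epsilon> :: real
    assume \<epsilon>: "\<epsilon> > 0" and "\<not> (\<exists>\<eta>\<in>span (range \<phi>). norm (\<psi> - \<eta>) < \<epsilon>)"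
    then have far: "\<epsilon> \<le> norm (\<psi> - \<eta>)" if "\<eta> \<in> span (range \<phi>)" for \<eta> using that by force
    let ?C = "(\<lambda>\<eta>. \<psi> - \<eta>) ` span (range \<phi>)"
    have "?C = (\<lambda>\<eta>. \<psi> + \<eta>) ` (uminus ` span (range \<phi>))" by (auto simp: image_image)
    then have "convex ?C"
      by (simp add: convex_translation convex_negations subspace_imp_convex)
    moreover have "?C \<noteq> {}" using span_zero by blast
    moreover have "\<epsilon> \<le> norm c" if "c \<in> ?C" for c using that far by blast
    ultimately obtain \<Phi> :: "('e \<Rightarrow>\<^sub>L real) \<Rightarrow>\<^sub>L real" where \<Phi>_C: "\<forall>c\<in>?C. \<epsilon> \<le> blinfun_apply \<Phi> c"
      using normed_convex_separation by metis
    have \<Phi>: "\<epsilon> \<le> blinfun_apply \<Phi> (\<psi> - \<eta>)" if "\<eta> \<in> span (range \<phi>)" for \<eta>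
      using \<Phi>_C that by blast
    obtain e where e: "\<And>\<phi>. blinfun_apply \<Phi> \<phi> = blinfun_apply \<phi> e"
      using reflexive unfolding reflexive_space_def by blast
    have zero: "blinfun_apply (\<phi> n) e = 0" for n
    proof (rule ccontr)
      assume ne: "blinfun_apply (\<phi> n) e \<noteq> 0"
      \<comment> \<open>The value of \<open>\<Phi>\<close> is bounded below on the line \<open>\<psi> - t \<phi>\<^sub>n\<close>; this \<open>t\<close> would make it \<open>0\<close>.\<close>
      define t where "t = blinfun_apply \<psi> e / blinfun_apply (\<phi> n) e"
      have "t *\<^sub>R \<phi> n \<in> span (range \<phi>)" by (intro span_scale span_base) auto
      from \<Phi>[OF this] show False using \<epsilon> ne by (simp add: e blinfun.bilinear_simps t_def)
    qed
    have "\<epsilon> \<le> blinfun_apply \<psi> e" using \<Phi>[of 0] by (simp add: e span_zero)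
    then have "e \<noteq> 0" using \<epsilon> by auto
    then obtain c where c: "c \<in> D" "c \<in> ball e (norm e / 2)" using D(2)[of "ball e (norm e / 2)"] by auto
    then obtain n where n: "c = d n" unfolding d_def using from_nat_into_surj[OF D(1)] by metis
    have "norm c = blinfun_apply (\<phi> n) (c - e)"
      using \<phi>(2)[of n] zero[of n] n by (simp add: blinfun.bilinear_simps)
    also have "\<dots> \<le> norm (\<phi> n) * norm (c - e)" using norm_blinfun[of "\<phi> n" "c - e"] by auto
    also have "\<dots> \<le> norm (c - e)" using \<phi>(1)[of n] by (simp add: mult_left_le_one_le)
    finally have "norm e \<le> norm (c - e) + norm (c - e)"
      using norm_triangle_ineq4[of c "c - e"] by simp
    then show False using c(2) by (simp add: dist_norm norm_minus_commute)
  qed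
qed

text \<open>A diagonal subsequence converges at a sequence of functionals whose span is dense, hence at every
functional, by boundedness. The limits form a bounded functional on the dual, which reflexivity represents
by a point.\<close>
lemma reflexive_bounded_imp_weakly_convergent_subseq:
  fixes es :: "nat \<Rightarrow> 'e::{banach, second_countable_topology}"
  assumes reflexive: "reflexive_space TYPE('e)" and R: "\<And>n. norm (es n) \<le> R"
  obtains s :: "nat \<Rightarrow> nat" and e :: 'e where "strict_mono s"
    "\<And>\<phi> :: 'e \<Rightarrow>\<^sub>L real. (\<lambda>i. blinfun_apply \<phi> (es (s i))) \<longlonglongrightarrow> blinfun_apply \<phi> e"
proof -
  obtain \<phi> :: "nat \<Rightarrow> 'e \<Rightarrow>\<^sub>L real" where \<phi>1: "\<And>n. norm (\<phi> n) \<le> 1"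
    and dense: "\<And>\<psi> \<epsilon>. \<epsilon> > 0 \<Longrightarrow> \<exists>\<eta>\<in>span (range \<phi>). norm (\<psi> - \<eta>) < \<epsilon>"
    using reflexive_dual_separable[OF reflexive] by blast
  have R0: "R \<ge> 0" using R[of 0] norm_ge_zero order_trans by blast
  have est: "\<bar>blinfun_apply \<psi> (es n)\<bar> \<le> norm \<psi> * R" for \<psi> :: "'e \<Rightarrow>\<^sub>L real" and n
    using norm_blinfun[of \<psi> "es n"] mult_left_mono[OF R[of n] norm_ge_zero[of \<psi>]] by simp
  have "\<bar>blinfun_apply (\<phi> k) (es n)\<bar> \<le> R" for k n
    using est[of "\<phi> k" n] \<phi>1[of k] R0 mult_right_mono[OF \<phi>1[of k] R0] by simp
  then have bound: "norm (blinfun_apply (\<phi> k) (es n)) \<le> R" for n k by simp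
  have "\<exists>s::nat \<Rightarrow> nat. strict_mono s \<and> (\<forall>k. \<exists>l. (\<lambda>i. blinfun_apply (\<phi> k) (es (s i))) \<longlonglongrightarrow> l)"
  proof (rule function_convergent_subsequence[of UNIV "\<lambda>n k. blinfun_apply (\<phi> k) (es n)" R])
    fix s :: "nat \<Rightarrow> nat"
    assume "strict_mono s" and "\<And>k. k \<in> UNIV \<Longrightarrow> \<exists>l. (\<lambda>i. blinfun_apply (\<phi> k) (es (s i))) \<longlonglongrightarrow> l"
    then show ?thesis by (intro exI[of _ s]) simp
  qed (use bound in auto)
  then obtain s :: "nat \<Rightarrow> nat" where s: "strict_mono s"
    and conv: "\<And>k. \<exists>l. (\<lambda>i. blinfun_apply (\<phi> k) (es (s i))) \<longlonglongrightarrow> l" by auto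
  have span_conv: "convergent (\<lambda>i. blinfun_apply \<eta> (es (s i)))" if "\<eta> \<in> span (range \<phi>)" for \<eta>
    using that
  proof (induction rule: span_induct_alt)
    case base
    then show ?case by (simp add: convergent_const)
  next
    case (step c x y)
    then have "convergent (\<lambda>i. blinfun_apply x (es (s i)))" using conv by (auto simp: convergent_def)
    then show ?case using step
      by (auto simp: blinfun.bilinear_simps intro!: convergent_add convergent_mult convergent_const)
  qed
  have conv_all: "convergent (\<lambda>i. blinfun_apply \<psi> (es (s i)))" for \<psi> :: "'e \<Rightarrow>\<^sub>L real"
  proof (rule Cauchy_convergent, rule metric_CauchyI)
    fix \<epsilon> :: real assume \<epsilon>: "\<epsilon> > 0"
    have pos: "\<epsilon> / (3 * (R + 1)) > 0" using \<epsilon> R0 by auto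
    obtain \<eta> where \<eta>: "\<eta> \<in> span (range \<phi>)" "norm (\<psi> - \<eta>) < \<epsilon> / (3 * (R + 1))"
      using dense[OF pos] by blast
    have close: "\<bar>blinfun_apply \<psi> (es n) - blinfun_apply \<eta> (es n)\<bar> < \<epsilon> / 3" for n
    proof -
      have "\<bar>blinfun_apply (\<psi> - \<eta>) (es n)\<bar> \<le> norm (\<psi> - \<eta>) * R" by (rule est)
      also have "\<dots> \<le> norm (\<psi> - \<eta>) * (R + 1)" by (intro mult_left_mono) auto
      also have "\<dots> < \<epsilon> / 3" using \<eta>(2) R0 by (simp add: field_simps)
      finally show ?thesis by (simp add: blinfun.bilinear_simps)
    qed
    have "Cauchy (\<lambda>i. blinfun_apply \<eta> (es (s i)))" using span_conv[OF \<eta>(1)] convergent_Cauchy by blast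
    then obtain M where M: "\<And>m n. m \<ge> M \<Longrightarrow> n \<ge> M \<Longrightarrow>
        dist (blinfun_apply \<eta> (es (s m))) (blinfun_apply \<eta> (es (s n))) < \<epsilon> / 3"
      using metric_CauchyD[of _ "\<epsilon> / 3"] \<epsilon> by (metis divide_pos_pos zero_less_numeral)
    show "\<exists>M. \<forall>m\<ge>M. \<forall>n\<ge>M. dist (blinfun_apply \<psi> (es (s m))) (blinfun_apply \<psi> (es (s n))) < \<epsilon>"
    proof (intro exI allI impI)
      fix m n assume "m \<ge> M" "n \<ge> M"
      from M[OF this] close[of "s m"] close[of "s n"]
      show "dist (blinfun_apply \<psi> (es (s m))) (blinfun_apply \<psi> (es (s n))) < \<epsilon>"
        unfolding dist_real_def by linarith
    qed
  qed
  define F where "F \<psi> = lim (\<lambda>i. blinfun_apply \<psi> (es (s i)))" for \<psi> :: "'e \<Rightarrow>\<^sub>L real"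
  have F: "(\<lambda>i. blinfun_apply \<psi> (es (s i))) \<longlonglongrightarrow> F \<psi>" for \<psi>
    using conv_all[of \<psi>] by (simp add: F_def convergent_LIMSEQ_iff)
  have "bounded_linear F"
  proof (rule bounded_linear_intro[of _ R])
    fix \<psi> \<eta> :: "'e \<Rightarrow>\<^sub>L real" and c :: real
    show "F (\<psi> + \<eta>) = F \<psi> + F \<eta>"
      using F[of "\<psi> + \<eta>"] tendsto_add[OF F[of \<psi>] F[of \<eta>]]
      by (intro LIMSEQ_unique[of "\<lambda>i. blinfun_apply (\<psi> + \<eta>) (es (s i))"]) (auto simp: blinfun.bilinear_simps)
    show "F (c *\<^sub>R \<psi>) = c *\<^sub>R F \<psi>"
      using F[of "c *\<^sub>R \<psi>"] tendsto_mult_left[OF F[of \<psi>], of c]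
      by (intro LIMSEQ_unique[of "\<lambda>i. blinfun_apply (c *\<^sub>R \<psi>) (es (s i))"]) (auto simp: blinfun.bilinear_simps)
    have "\<bar>F \<psi>\<bar> \<le> norm \<psi> * R"
      using tendsto_rabs[OF F[of \<psi>]] by (rule LIMSEQ_le_const2) (use est in auto)
    then show "norm (F \<psi>) \<le> norm \<psi> * R" by simp
  qed
  then have BF: "blinfun_apply (Blinfun F) = F" by (rule bounded_linear_Blinfun_apply)
  obtain e where "\<And>\<psi>. blinfun_apply (Blinfun F) \<psi> = blinfun_apply \<psi> e"
    using reflexive unfolding reflexive_space_def by blast
  then show ?thesis using s F BF by (intro that[of s e]) auto
qed

text \<open>The epi-limit of the full sequence also bounds limits taken along a subsequence: the missing places are
filled with the limit point, and passing to the subsequence only increases the lower limit.\<close>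
lemma seq_li_e_subseq_le:
  fixes es :: "nat \<Rightarrow> 'e::real_normed_vector"
  assumes r: "strict_mono r"
    and lim: "\<And>\<phi> :: 'e \<Rightarrow>\<^sub>L real. (\<lambda>i. blinfun_apply \<phi> (es i)) \<longlonglongrightarrow> blinfun_apply \<phi> e"
  shows "seq_li_e weak_topology g e \<le> liminf (\<lambda>i. g (r i) (es i))"
proof -
  define es' where "es' n = (if n \<in> range r then es (inv r n) else e)" for n
  have inj: "inj r" using r by (simp add: strict_mono_imp_inj_on)
  have r_es': "es' (r i) = es i" for i by (simp add: es'_def inj)
  have "(\<lambda>n. blinfun_apply \<phi> (es' n)) \<longlonglongrightarrow> blinfun_apply \<phi> e" for \<phi> :: "'e \<Rightarrow>\<^sub>L real"
  proof (rule topological_tendstoI)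
    fix U assume U: "open U" "blinfun_apply \<phi> e \<in> U"
    then obtain I where I: "\<And>i. i \<ge> I \<Longrightarrow> blinfun_apply \<phi> (es i) \<in> U"
      using topological_tendstoD[OF lim[of \<phi>] U] by (auto simp: eventually_sequentially)
    have "blinfun_apply \<phi> (es' n) \<in> U" if n: "n \<ge> r I" for n
    proof (cases "n \<in> range r")
      case True
      then obtain i where i: "n = r i" by auto
      then have "i \<ge> I" using n r by (simp add: strict_mono_less_eq)
      then show ?thesis using I i r_es' by simp
    qed (use U in \<open>simp add: es'_def\<close>)
    then show "eventually (\<lambda>n. blinfun_apply \<phi> (es' n) \<in> U) sequentially"
      by (auto simp: eventually_sequentially)
  qed
  then have "limitin weak_topology es' e sequentially" by (rule limitin_weak_topologyI)
  then have "seq_li_e weak_topology g e \<le> liminf (\<lambda>n. g n (es' n))"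
    unfolding seq_li_e_def by (intro Inf_lower) (auto simp: topspace_weak_topology)
  also have "\<dots> \<le> liminf ((\<lambda>n. g n (es' n)) \<circ> r)" by (rule liminf_subseq_mono[OF r])
  finally show ?thesis by (simp add: o_def r_es')
qed

text \<open>Were the inequality violated infinitely often, the violating points would have a weak limit \<open>e\<close>, at which
the epi-limit is at most \<open>\<phi> e - c - \<delta>\<close>; the conjugate at \<open>\<phi>\<close> would then be at least \<open>c + \<delta>\<close>.\<close>
lemma eventually_bounded_conjugate_bound:
  fixes es :: "nat \<Rightarrow> 'e::{banach, second_countable_topology}"
  assumes reflexive: "reflexive_space TYPE('e)" and r: "strict_mono r"
    and c: "conjugate (seq_li_e weak_topology g) \<phi> \<le> ereal c" and \<delta>: "\<delta> > 0"
  shows "eventually (\<lambda>m. norm (es m) \<le> R \<longrightarrow> ereal (blinfun_apply \<phi> (es m) - c - \<delta>) \<le> g (r m) (es m)) sequentially"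
proof (rule ccontr)
  assume "\<not> ?thesis"
  from not_eventually_sequentiallyD[OF this]
  obtain t :: "nat \<Rightarrow> nat" where t: "strict_mono t" "\<And>i. norm (es (t i)) \<le> R"
      "\<And>i. g (r (t i)) (es (t i)) < ereal (blinfun_apply \<phi> (es (t i)) - c - \<delta>)"
    by (auto simp: not_le)
  obtain s e where s: "strict_mono s"
    and lim: "\<And>\<phi> :: 'e \<Rightarrow>\<^sub>L real. (\<lambda>i. blinfun_apply \<phi> (es (t (s i)))) \<longlonglongrightarrow> blinfun_apply \<phi> e"
    using reflexive_bounded_imp_weakly_convergent_subseq[OF reflexive, of "\<lambda>i. es (t i)" R] t(2) by blast
  let ?l = "blinfun_apply \<phi> e - c - \<delta>"
  have "strict_mono (\<lambda>i. r (t (s i)))" using r t(1) s by (simp add: strict_mono_def)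
  from seq_li_e_subseq_le[OF this lim]
  have "seq_li_e weak_topology g e \<le> liminf (\<lambda>i. g (r (t (s i))) (es (t (s i))))" .
  also have "\<dots> \<le> liminf (\<lambda>i. ereal (blinfun_apply \<phi> (es (t (s i))) - c - \<delta>))"
    using t(3) by (intro Liminf_mono always_eventually) (auto intro: less_imp_le)
  also have "\<dots> = ereal ?l"
    by (intro lim_imp_Liminf) (simp_all only: lim_ereal trivial_limit_sequentially not_False_eq_True,
      intro tendsto_diff tendsto_const lim)
  finally have le: "seq_li_e weak_topology g e \<le> ereal ?l" .
  have "ereal (c + \<delta>) = ereal (blinfun_apply \<phi> e) - ereal ?l" by simp
  also have "\<dots> \<le> ereal (blinfun_apply \<phi> e) - seq_li_e weak_topology g e"
    using le by (intro ereal_minus_mono) auto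
  also have "\<dots> \<le> conjugate (seq_li_e weak_topology g) \<phi>"
    unfolding conjugate_def by (intro SUP_upper) auto
  also note c
  finally show False using \<delta> by simp
qed

text \<open>Testing with real upper bounds of the conjugate covers its infinite values: the value \<open>\<infinity>\<close> contributes
nothing to the supremum, and the value \<open>-\<infinity>\<close> has all reals as upper bounds.\<close>
lemma biconjugate_leI:
  assumes "\<And>\<phi> c. conjugate g \<phi> \<le> ereal c \<Longrightarrow> ereal (blinfun_apply \<phi> e - c) \<le> v"
  shows "biconjugate g e \<le> v"
  unfolding biconjugate_def
proof (rule SUP_least)
  fix \<phi>
  show "ereal (blinfun_apply \<phi> e) - conjugate g \<phi> \<le> v"
  proof (cases "conjugate g \<phi>")
    case (real c)
    then show ?thesis using assms[of \<phi> c] by simp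
  next
    case MInf
    have "ereal B \<le> v" for B using assms[of \<phi> "blinfun_apply \<phi> e - B"] MInf by simp
    then have "v = \<infinity>" by (rule ereal_top)
    then show ?thesis by simp
  qed simp
qed

text \<open>The threshold is \<open>Suc R\<close> rather than \<open>R\<close>, so that penalised points have norm at least \<open>1\<close> and \<open>K \<parallel>e m\<parallel>\<close>
also dominates constants.\<close>
definition penalized_average ::
  "(nat \<Rightarrow> nat) \<Rightarrow> (nat \<Rightarrow> nat \<Rightarrow> real) \<Rightarrow> (nat \<Rightarrow> 'e::real_normed_vector) \<Rightarrow> (nat \<Rightarrow> real) \<Rightarrow> nat \<Rightarrow> nat \<Rightarrow> nat \<Rightarrow> real" where
  "penalized_average q w e p K R j =
     (\<Sum>m=j..<q j. w j m * (p m + real K * (if norm (e m) > real (Suc R) then norm (e m) else 0)))"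

text \<open>The core of the argument, at a fixed point \<open>\<omega>\<close>: terms of bounded norm are controlled by the epi-limit,
the others by the penalty, and both bounds survive averaging because they are affine in the point.\<close>
lemma conjugate_bound_penalized_average:
  fixes es :: "nat \<Rightarrow> 'e::{banach, second_countable_topology}"
  assumes reflexive: "reflexive_space TYPE('e)" and r: "strict_mono r"
    and w: "\<And>j. tail_weights j (q j) (w j)"
    and y: "(\<lambda>j. \<Sum>m=j..<q j. w j m *\<^sub>R es m) \<longlonglongrightarrow> e"
    and p0: "\<And>m. 0 \<le> p m" and p: "\<And>m. g (r m) (es m) \<le> ereal (p m - H)" and H: "0 \<le> H"
    and c: "conjugate (seq_li_e weak_topology g) \<phi> \<le> ereal c"
  shows "ennreal (blinfun_apply \<phi> e - c + H) \<le>
    (SUP K. INF R. liminf (\<lambda>j. ennreal (penalized_average q w es p K R j)))"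
proof -
  define K where "K = nat \<lceil>norm \<phi> + \<bar>c\<bar> + 1 + H\<rceil>"
  have K: "norm \<phi> + \<bar>c\<bar> + 1 + H \<le> real K" unfolding K_def by linarith
  have K0: "real K \<ge> 0" by simp
  have "ennreal (blinfun_apply \<phi> e - c + H) \<le> liminf (\<lambda>j. ennreal (penalized_average q w es p K R j))" for R
  proof -
    have \<delta>: "ennreal (blinfun_apply \<phi> e - c + H - \<delta>) \<le> liminf (\<lambda>j. ennreal (penalized_average q w es p K R j))"
      if \<delta>: "0 < \<delta>" "\<delta> \<le> 1" for \<delta>
    proof -
      let ?b = "\<lambda>m. p m + real K * (if norm (es m) > real (Suc R) then norm (es m) else 0)"
      have "eventually (\<lambda>m. blinfun_apply \<phi> (es m) - c + H - \<delta> \<le> ?b m) sequentially"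
        using eventually_bounded_conjugate_bound[OF reflexive r c \<delta>(1), of es "real (Suc R)"]
      proof eventually_elim
        case (elim m)
        show ?case
        proof (cases "norm (es m) > real (Suc R)")
          case True
          then have n1: "norm (es m) \<ge> 1" by simp
          have "blinfun_apply \<phi> (es m) \<le> norm \<phi> * norm (es m)" using norm_blinfun[of \<phi> "es m"] by auto
          moreover have "\<bar>c\<bar> + H \<le> (\<bar>c\<bar> + 1 + H) * norm (es m)"
            using mult_left_mono[OF n1, of "\<bar>c\<bar> + 1 + H"] H by simp
          moreover have "(norm \<phi> + \<bar>c\<bar> + 1 + H) * norm (es m) \<le> real K * norm (es m)"
            by (intro mult_right_mono K) auto
          ultimately have "blinfun_apply \<phi> (es m) - c + H \<le> real K * norm (es m)"
            by (simp add: distrib_right) 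
          then show ?thesis using True p0[of m] \<delta> by simp
        next
          case False
          then have "ereal (blinfun_apply \<phi> (es m) - c - \<delta>) \<le> ereal (p m - H)"
            using elim p[of m] by (meson not_less order_trans)
          then show ?thesis using False by simp
        qed
      qed
      then obtain n where n: "\<And>m. m \<ge> n \<Longrightarrow> blinfun_apply \<phi> (es m) - c + H - \<delta> \<le> ?b m"
        by (auto simp: eventually_sequentially)
      let ?y = "\<lambda>j. \<Sum>m=j..<q j. w j m *\<^sub>R es m"
      have le: "blinfun_apply \<phi> (?y j) - c + H - \<delta> \<le> penalized_average q w es p K R j" if j: "j \<ge> n" for j
      proof -
        have w1: "(\<Sum>m=j..<q j. w j m) = 1" and w0: "\<And>m. 0 \<le> w j m" using w[of j] by (auto simp: tail_weights_def)
        have "blinfun_apply \<phi> (?y j) - c + H - \<delta> =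
          (\<Sum>m=j..<q j. w j m * blinfun_apply \<phi> (es m)) + (\<Sum>m=j..<q j. w j m) * (- c + H - \<delta>)"
          by (simp add: blinfun.sum_right blinfun.scaleR_right w1)
        also have "\<dots> = (\<Sum>m=j..<q j. w j m * (blinfun_apply \<phi> (es m) - c + H - \<delta>))"
          unfolding sum_distrib_right sum.distrib[symmetric]
          by (rule sum.cong[OF refl]) (simp add: algebra_simps)
        also have "\<dots> \<le> penalized_average q w es p K R j"
          unfolding penalized_average_def using n j w0 by (intro sum_mono mult_left_mono) auto
        finally show ?thesis .
      qed
      have "(\<lambda>j. blinfun_apply \<phi> (?y j)) \<longlonglongrightarrow> blinfun_apply \<phi> e" using y by (rule bounded_linear.tendsto[OF blinfun.bounded_linear_right])
      then have "(\<lambda>j. ennreal (blinfun_apply \<phi> (?y j) - c + H - \<delta>)) \<longlonglongrightarrow> ennreal (blinfun_apply \<phi> e - c + H - \<delta>)"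
        by (intro tendsto_ennrealI tendsto_diff tendsto_add tendsto_const)
      then have "ennreal (blinfun_apply \<phi> e - c + H - \<delta>) = liminf (\<lambda>j. ennreal (blinfun_apply \<phi> (?y j) - c + H - \<delta>))"
        by (intro lim_imp_Liminf[symmetric]) auto
      also have "\<dots> \<le> liminf (\<lambda>j. ennreal (penalized_average q w es p K R j))"
        using le by (intro Liminf_mono) (auto simp: eventually_sequentially intro!: exI[of _ n] ennreal_leI)
      finally show ?thesis .
    qed
    have "(\<lambda>n. blinfun_apply \<phi> e - c + H - 1 / real (Suc n)) \<longlonglongrightarrow> blinfun_apply \<phi> e - c + H - 0"
      by (intro tendsto_diff tendsto_const LIMSEQ_Suc[OF lim_1_over_n])
    then have "(\<lambda>n. ennreal (blinfun_apply \<phi> e - c + H - 1 / real (Suc n))) \<longlonglongrightarrow> ennreal (blinfun_apply \<phi> e - c + H)"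
      by (intro tendsto_ennrealI) simp
    then show ?thesis by (rule LIMSEQ_le_const2) (use \<delta> in auto)
  qed
  then show ?thesis by (intro SUP_upper2[of K] INF_greatest) auto
qed


section \<open>Integration and the lower semicontinuity theorem\<close>

text \<open>Take \<open>H = t 1\<^sub>K\<close>, with \<open>K\<close> and \<open>\<eta>\<close> from equi-integrability for \<open>\<epsilon> / 2\<close>. The excess \<open>(u - H)\<^sup>+\<close> lives
outside \<open>K\<close> and on \<open>{u > t}\<close>, and the latter has measure at most \<open>\<eta>\<close> by Markov's inequality, for \<open>t\<close>
above the \<open>L\<^sub>1\<close>-bound divided by \<open>\<eta>\<close>.\<close>
lemma uniformly_integrable_dominated_up_to:
  assumes UI: "uniformly_integrable M X" and nonneg: "\<forall>u\<in>X. \<forall>\<omega>. 0 \<le> u \<omega>" and \<epsilon>: "\<epsilon> > 0"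
  obtains H :: "'a \<Rightarrow> real" where "integrable M H" "\<forall>\<omega>. 0 \<le> H \<omega>"
    "\<forall>u\<in>X. (\<integral>\<omega>. max (u \<omega> - H \<omega>) 0 \<partial>M) \<le> \<epsilon>"
proof -
  have pos: "0 \<le> u \<omega>" if "u \<in> X" for u \<omega> using nonneg that by blast
  obtain C where C: "\<And>u. u \<in> X \<Longrightarrow> (\<integral>\<omega>. \<bar>u \<omega>\<bar> \<partial>M) \<le> C" and eq: "equi_integrable M X"
    using UI unfolding uniformly_integrable_def by auto
  have "X \<subseteq> L1 M" using eq unfolding equi_integrable_def by (rule conjunct1)
  then have int: "integrable M u" if "u \<in> X" for u using that by (auto simp: L1_def)
  have \<epsilon>2: "\<epsilon> / 2 > 0" using \<epsilon> by simp
  obtain \<eta> K where \<eta>: "\<eta> > 0" and K: "K \<in> sets M" "emeasure M K < \<infinity>"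
    and smallA: "\<And>A. A \<in> sets M \<Longrightarrow> emeasure M A \<le> ennreal \<eta> \<Longrightarrow>
        (SUP u\<in>X. \<integral>\<^sup>+\<omega>. ennreal \<bar>u \<omega> * indicator A \<omega>\<bar> \<partial>M) < ennreal (\<epsilon> / 2)"
    and smallK: "(SUP u\<in>X. \<integral>\<^sup>+\<omega>. ennreal \<bar>u \<omega> * indicator (space M - K) \<omega>\<bar> \<partial>M) < ennreal (\<epsilon> / 2)"
    using eq[unfolded equi_integrable_def, THEN conjunct2, rule_format, OF \<epsilon>2] by blast
  define t where "t = (\<bar>C\<bar> + 1) / \<eta>"
  have t: "t > 0" using \<eta> by (simp add: t_def add_pos_nonneg)
  define H :: "'a \<Rightarrow> real" where "H \<omega> = t * indicator K \<omega>" for \<omega>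
  show ?thesis
  proof (rule that[of H])
    show Hint: "integrable M H" unfolding H_def[abs_def] using K by auto
    show "\<forall>\<omega>. 0 \<le> H \<omega>" using t by (simp add: H_def)
    show "\<forall>u\<in>X. (\<integral>\<omega>. max (u \<omega> - H \<omega>) 0 \<partial>M) \<le> \<epsilon>"
    proof
      fix u assume u: "u \<in> X"
      have [measurable]: "u \<in> borel_measurable M" "K \<in> sets M" using int[OF u] K by auto
      define A where "A = {\<omega> \<in> space M. u \<omega> > t}"
      have A [measurable]: "A \<in> sets M" unfolding A_def by measurable
      have "emeasure M A = (\<integral>\<^sup>+\<omega>. indicator A \<omega> \<partial>M)" using A by simp
      also have "\<dots> \<le> (\<integral>\<^sup>+\<omega>. ennreal (u \<omega> / t) \<partial>M)"
        using t pos[OF u] by (intro nn_integral_mono) (auto simp: A_def indicator_def)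
      also have "\<dots> = ennreal (\<integral>\<omega>. u \<omega> / t \<partial>M)"
        using int[OF u] t pos[OF u] by (intro nn_integral_eq_integral) auto
      also have "\<dots> \<le> ennreal \<eta>"
      proof (rule ennreal_leI)
        have "(\<integral>\<omega>. u \<omega> \<partial>M) \<le> \<bar>C\<bar> + 1" using C[OF u] pos[OF u] by simp
        moreover have "\<bar>C\<bar> + 1 = t * \<eta>" using \<eta> by (simp add: t_def)
        ultimately show "(\<integral>\<omega>. u \<omega> / t \<partial>M) \<le> \<eta>" using t by (simp add: divide_le_eq mult.commute)
      qed
      finally have sup_A: "(SUP u\<in>X. \<integral>\<^sup>+\<omega>. ennreal \<bar>u \<omega> * indicator A \<omega>\<bar> \<partial>M) < ennreal (\<epsilon> / 2)"
        by (rule smallA[OF A])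
      have a: "(\<integral>\<^sup>+\<omega>. ennreal \<bar>u \<omega> * indicator A \<omega>\<bar> \<partial>M) \<le> ennreal (\<epsilon> / 2)"
        by (rule order_trans[OF SUP_upper[OF u] less_imp_le[OF sup_A]])
      have b: "(\<integral>\<^sup>+\<omega>. ennreal \<bar>u \<omega> * indicator (space M - K) \<omega>\<bar> \<partial>M) \<le> ennreal (\<epsilon> / 2)"
        by (rule order_trans[OF SUP_upper[OF u] less_imp_le[OF smallK]])
      have mint: "integrable M (\<lambda>\<omega>. max (u \<omega> - H \<omega>) 0)"
        using int[OF u] Hint by auto
      have "ennreal (\<integral>\<omega>. max (u \<omega> - H \<omega>) 0 \<partial>M) = (\<integral>\<^sup>+\<omega>. ennreal (max (u \<omega> - H \<omega>) 0) \<partial>M)"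
        using mint by (intro nn_integral_eq_integral[symmetric]) auto
      also have "\<dots> \<le> (\<integral>\<^sup>+\<omega>. ennreal \<bar>u \<omega> * indicator A \<omega>\<bar> + ennreal \<bar>u \<omega> * indicator (space M - K) \<omega>\<bar> \<partial>M)"
      proof (rule nn_integral_mono)
        fix \<omega> assume \<omega>: "\<omega> \<in> space M"
        show "ennreal (max (u \<omega> - H \<omega>) 0) \<le> ennreal \<bar>u \<omega> * indicator A \<omega>\<bar> + ennreal \<bar>u \<omega> * indicator (space M - K) \<omega>\<bar>"
          using pos[OF u, of \<omega>] t \<omega> by (subst ennreal_plus[symmetric]) (auto simp: H_def A_def indicator_def intro!: ennreal_leI)
      qed
      also have "\<dots> = (\<integral>\<^sup>+\<omega>. ennreal \<bar>u \<omega> * indicator A \<omega>\<bar> \<partial>M) + (\<integral>\<^sup>+\<omega>. ennreal \<bar>u \<omega> * indicator (space M - K) \<omega>\<bar> \<partial>M)"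
        by (intro nn_integral_add) auto
      also have "\<dots> \<le> ennreal (\<epsilon> / 2) + ennreal (\<epsilon> / 2)" using a b by (rule add_mono)
      also have "\<dots> = ennreal \<epsilon>" using \<epsilon> by (subst ennreal_plus[symmetric]) auto
      finally show "(\<integral>\<omega>. max (u \<omega> - H \<omega>) 0 \<partial>M) \<le> \<epsilon>" using \<epsilon> by (simp add: ennreal_le_iff)
    qed
  qed
qed

lemma upper_integral_less_imp_integrable:
  assumes v [measurable]: "v \<in> borel_measurable M"
    and fin: "AE \<omega> in M. neg_part (v \<omega>) < \<infinity>" and neg: "integrable M (\<lambda>\<omega>. real_of_ereal (neg_part (v \<omega>)))"
    and less: "upper_integral M v < ereal B"
  shows "integrable M (\<lambda>\<omega>. real_of_ereal (v \<omega>))"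
    and "AE \<omega> in M. v \<omega> = ereal (real_of_ereal (v \<omega>))"
    and "(\<integral>\<omega>. real_of_ereal (v \<omega>) \<partial>M) \<le> B"
proof -
  obtain u where u: "integrable M u" "AE \<omega> in M. v \<omega> \<le> ereal (u \<omega>)" "(\<integral>\<omega>. u \<omega> \<partial>M) < B"
    using less unfolding upper_integral_def by (auto simp: Inf_less_iff)
  show real: "AE \<omega> in M. v \<omega> = ereal (real_of_ereal (v \<omega>))"
    using u(2) fin
  proof eventually_elim
    case (elim \<omega>)
    then show ?case by (cases "v \<omega>") (auto simp: neg_part_def)
  qed
  have le: "AE \<omega> in M. real_of_ereal (v \<omega>) \<le> u \<omega>" using u(2) real
  proof eventually_elim
    case (elim \<omega>)
    then show ?case by (metis ereal_less_eq(3))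
  qed
  show int: "integrable M (\<lambda>\<omega>. real_of_ereal (v \<omega>))"
  proof (rule Bochner_Integration.integrable_bound)
    show "integrable M (\<lambda>\<omega>. \<bar>u \<omega>\<bar> + real_of_ereal (neg_part (v \<omega>)))" using u(1) neg by auto
    show "AE \<omega> in M. norm (real_of_ereal (v \<omega>)) \<le> norm (\<bar>u \<omega>\<bar> + real_of_ereal (neg_part (v \<omega>)))"
      using real le
    proof eventually_elim
      case (elim \<omega>)
      obtain a where a: "v \<omega> = ereal a" using elim by metis
      have "real_of_ereal (neg_part (v \<omega>)) = max (- a) 0"
        by (simp add: a neg_part_def max_def zero_ereal_def)
      moreover have "a \<le> u \<omega>" "real_of_ereal (v \<omega>) = a" using elim by (simp_all add: a)
      ultimately show ?case by simp
    qed
  qed simp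
  show "(\<integral>\<omega>. real_of_ereal (v \<omega>) \<partial>M) \<le> B"
    using integral_mono_AE[OF int u(1) le] u(3) by linarith
qed

text \<open>The norms are summable in \<open>L\<^sub>1\<close> when each is restricted to its own \<open>\<Omega> j\<close>; almost every point lies in all
but finitely many \<open>\<Omega> j\<close>, so the restrictions disappear in the limit.\<close>
lemma averages_converge_AE:
  fixes z :: "nat \<Rightarrow> 'a \<Rightarrow> 'e::{banach, second_countable_topology}"
  assumes \<Omega>: "incseq \<Omega>" "\<And>k. \<Omega> k \<in> sets M" "AE \<omega> in M. \<omega> \<in> (\<Union>k. \<Omega> k)"
    and [measurable]: "\<And>j. z j \<in> borel_measurable M"
    and z: "\<And>j. z j \<in> L1 (restrict_space M (\<Omega> j))"
    and small: "\<And>j. L1_norm (restrict_space M (\<Omega> j)) (z j) < (1/2) ^ j"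
  shows "AE \<omega> in M. (\<lambda>j. z j \<omega>) \<longlonglongrightarrow> 0"
proof -
  let ?a = "\<lambda>j \<omega>. indicator (\<Omega> j) \<omega> * norm (z j \<omega>)"
  have [measurable]: "\<And>k. \<Omega> k \<in> sets M" by fact
  have "(\<integral>\<^sup>+\<omega>. (\<Sum>j. ennreal (?a j \<omega>)) \<partial>M) = (\<Sum>j. \<integral>\<^sup>+\<omega>. ennreal (?a j \<omega>) \<partial>M)"
    by (intro nn_integral_suminf) measurable
  also have "\<dots> \<le> (\<Sum>j. ennreal ((1/2) ^ j))"
  proof (intro suminf_le summableI)
    fix j
    have "integrable (restrict_space M (\<Omega> j)) (\<lambda>\<omega>. norm (z j \<omega>))" using z[of j] by (auto simp: L1_def)
    then have "integrable M (?a j)" by (subst (asm) integrable_restrict_space) auto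
    then have "(\<integral>\<^sup>+\<omega>. ennreal (?a j \<omega>) \<partial>M) = ennreal (\<integral>\<omega>. ?a j \<omega> \<partial>M)"
      by (intro nn_integral_eq_integral) auto
    also have "(\<integral>\<omega>. ?a j \<omega> \<partial>M) = L1_norm (restrict_space M (\<Omega> j)) (z j)"
      by (subst integral_restrict_space) auto
    finally show "(\<integral>\<^sup>+\<omega>. ennreal (?a j \<omega>) \<partial>M) \<le> ennreal ((1/2) ^ j)"
      using small[of j] by (simp add: ennreal_leI)
  qed
  also have "\<dots> = ennreal (\<Sum>j. (1/2) ^ j)" by (intro suminf_ennreal2) (auto intro: summable_geometric)
  also have "\<dots> < \<infinity>" by simp
  finally have "AE \<omega> in M. (\<Sum>j. ennreal (?a j \<omega>)) \<noteq> \<infinity>"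
    by (intro nn_integral_PInf_AE) auto
  then show ?thesis using \<Omega>(3)
  proof eventually_elim
    case (elim \<omega>)
    then obtain k where k: "\<omega> \<in> \<Omega> k" by blast
    have "summable (\<lambda>j. ?a j \<omega>)" using elim by (intro summable_suminf_not_top) auto
    then have "(\<lambda>j. ?a j \<omega>) \<longlonglongrightarrow> 0" by (rule summable_LIMSEQ_zero)
    moreover have "eventually (\<lambda>j. ?a j \<omega> = norm (z j \<omega>)) sequentially"
      using k \<Omega>(1) by (auto simp: eventually_sequentially incseq_def indicator_def intro!: exI[of _ k])
    ultimately have "(\<lambda>j. norm (z j \<omega>)) \<longlonglongrightarrow> 0" using Lim_transform_eventually by fast
    then show ?case by (simp add: tendsto_norm_zero_iff)
  qed
qed

text \<open>Monotone convergence in \<open>K\<close> reduces to a fixed \<open>K\<close>. Then \<open>R\<close> is chosen so large that the tails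
beyond \<open>R\<close> have integral at most \<open>e / (K + 1)\<close>, and Fatou's lemma is applied in \<open>j\<close>.\<close>
lemma nn_integral_penalized_averages_le:
  fixes xs :: "nat \<Rightarrow> 'a \<Rightarrow> 'e::{banach, second_countable_topology}"
  assumes w: "\<And>j. tail_weights j (q j) (w j)"
    and xs: "\<And>m. xs m \<in> L1 N"
    and UI: "\<And>\<epsilon>. \<epsilon> > 0 \<Longrightarrow> \<exists>R n. \<forall>m\<ge>n. (\<integral>\<omega>. (if norm (xs m \<omega>) > R then norm (xs m \<omega>) else 0) \<partial>N) \<le> \<epsilon>"
    and p: "\<And>m. integrable N (p m)" "\<And>m \<omega>. 0 \<le> p m \<omega>" "\<And>m. (\<integral>\<omega>. p m \<omega> \<partial>N) \<le> C"
  shows "(\<integral>\<^sup>+\<omega>. (SUP K. INF R. liminf (\<lambda>j. ennreal (penalized_average q w (\<lambda>m. xs m \<omega>) (\<lambda>m. p m \<omega>) K R j))) \<partial>N) \<le> ennreal C"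
proof -
  define T where "T K R j \<omega> = penalized_average q w (\<lambda>m. xs m \<omega>) (\<lambda>m. p m \<omega>) K R j" for K R j \<omega>
  define big where "big R m \<omega> = (if norm (xs m \<omega>) > R then norm (xs m \<omega>) else 0)" for R :: real and m \<omega>
  have T_eq: "T K R j \<omega> = (\<Sum>m=j..<q j. w j m * (p m \<omega> + real K * big (real (Suc R)) m \<omega>))" for K R j \<omega>
    by (simp add: T_def penalized_average_def big_def)
  have xsi: "integrable N (xs m)" for m using xs by (auto simp: L1_def)
  have [measurable]: "xs m \<in> borel_measurable N" "p m \<in> borel_measurable N" for m using xsi p(1) by auto
  have w0: "0 \<le> w j m" and w1: "(\<Sum>m=j..<q j. w j m) = 1" for j m using w[of j] by (auto simp: tail_weights_def)
  have big0: "0 \<le> big R m \<omega>" for R m \<omega> by (simp add: big_def)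
  have bigi: "integrable N (big R m)" for R m unfolding big_def[abs_def]
    by (rule Bochner_Integration.integrable_bound[OF integrable_norm[OF xsi[of m]]]) auto
  have T0: "0 \<le> T K R j \<omega>" for K R j \<omega>
    unfolding T_eq using w0 p(2) big0 by (intro sum_nonneg mult_nonneg_nonneg add_nonneg_nonneg) auto
  have Ti: "integrable N (T K R j)" for K R j
    unfolding T_eq[abs_def] using p(1) bigi by (intro Bochner_Integration.integrable_sum integrable_mult_right Bochner_Integration.integrable_add) auto
  have [measurable]: "T K R j \<in> borel_measurable N" for K R j using Ti by auto
  have C0: "0 \<le> C" using Bochner_Integration.integral_nonneg[of N "p 0"] p(3)[of 0] p(2) by fastforce
  define G where "G K \<omega> = (INF R. liminf (\<lambda>j. ennreal (T K R j \<omega>)))" for K \<omega>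
  have [measurable]: "G K \<in> borel_measurable N" for K unfolding G_def by measurable
  have "incseq G"
  proof (rule incseq_SucI, rule le_funI)
    fix K \<omega>
    have "T K R j \<omega> \<le> T (Suc K) R j \<omega>" for R j
      unfolding T_eq using w0 big0 by (intro sum_mono mult_left_mono add_left_mono mult_right_mono) auto
    then show "G K \<omega> \<le> G (Suc K) \<omega>"
      unfolding G_def by (intro INF_mono' Liminf_mono always_eventually allI ennreal_leI)
  qed
  then have "(\<integral>\<^sup>+\<omega>. (SUP K. G K \<omega>) \<partial>N) = (SUP K. integral\<^sup>N N (G K))"
    by (intro nn_integral_monotone_convergence_SUP) auto
  also have "\<dots> \<le> ennreal C"
  proof (rule SUP_least, rule ennreal_le_epsilon)
    fix K and e :: real assume e: "e > 0"
    have "e / (real K + 1) > 0" using e by (simp add: add_nonneg_pos)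
    from UI[OF this] obtain R0 n where R0: "\<And>m. m \<ge> n \<Longrightarrow> (\<integral>\<omega>. big R0 m \<omega> \<partial>N) \<le> e / (real K + 1)"
      unfolding big_def by blast
    define R where "R = nat \<lceil>R0\<rceil>"
    have RR0: "R0 \<le> real (Suc R)" unfolding R_def by linarith
    have "(\<integral>\<^sup>+\<omega>. ennreal (T K R j \<omega>) \<partial>N) \<le> ennreal (C + e)" if j: "j \<ge> n" for j
    proof -
      have "(\<integral>\<omega>. T K R j \<omega> \<partial>N) = (\<Sum>m=j..<q j. w j m * ((\<integral>\<omega>. p m \<omega> \<partial>N) + real K * (\<integral>\<omega>. big (real (Suc R)) m \<omega> \<partial>N)))"
        unfolding T_eq using p(1) bigi by simp
      also have "\<dots> \<le> (\<Sum>m=j..<q j. w j m * (C + e))"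
      proof (intro sum_mono mult_left_mono add_mono p(3) w0)
        fix m assume "m \<in> {j..<q j}"
        then have m: "m \<ge> n" using j by simp
        have "(\<integral>\<omega>. big (real (Suc R)) m \<omega> \<partial>N) \<le> (\<integral>\<omega>. big R0 m \<omega> \<partial>N)"
          using RR0 by (intro integral_mono bigi) (auto simp: big_def)
        also note R0[OF m]
        finally have "real K * (\<integral>\<omega>. big (real (Suc R)) m \<omega> \<partial>N) \<le> real K * (e / (real K + 1))"
          by (rule mult_left_mono) simp
        also have "\<dots> \<le> e" using e by (simp add: field_simps)
        finally show "real K * (\<integral>\<omega>. big (real (Suc R)) m \<omega> \<partial>N) \<le> e" .
      qed
      also have "\<dots> = C + e" by (simp add: sum_distrib_right[symmetric] w1)
      finally show ?thesis
        using Ti T0 by (subst nn_integral_eq_integral) (auto intro: ennreal_leI)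
    qed
    then have ev: "eventually (\<lambda>j. (\<integral>\<^sup>+\<omega>. ennreal (T K R j \<omega>) \<partial>N) \<le> ennreal (C + e)) sequentially"
      by (auto simp: eventually_sequentially)
    have "integral\<^sup>N N (G K) \<le> (\<integral>\<^sup>+\<omega>. liminf (\<lambda>j. ennreal (T K R j \<omega>)) \<partial>N)"
      unfolding G_def by (intro nn_integral_mono INF_lower) auto
    also have "\<dots> \<le> liminf (\<lambda>j. \<integral>\<^sup>+\<omega>. ennreal (T K R j \<omega>) \<partial>N)"
      by (intro nn_integral_liminf) measurable
    also have "\<dots> \<le> liminf (\<lambda>j. ennreal (C + e))" by (rule Liminf_mono[OF ev])
    also have "\<dots> = ennreal C + ennreal e" using C0 e by (simp add: Liminf_const)
    finally show "integral\<^sup>N N (G K) \<le> ennreal C + ennreal e" .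
  qed
  finally show ?thesis by (simp add: G_def T_def)
qed

lemma weakly_converges_L1_dual_ball:
  assumes "weakly_converges_L1 N xs x"
  shows "xs n \<in> L1 N" and "x \<in> L1 N" and "\<Lambda> \<in> dual_ball N \<Longrightarrow> (\<lambda>n. \<Lambda> (xs n)) \<longlonglongrightarrow> \<Lambda> x"
proof -
  have lim: "limitin (initial_topology (L1 N) (L1_dual N)) xs x sequentially" and xs: "\<And>n. xs n \<in> L1 N"
    using assms by (auto simp: weakly_converges_L1_def)
  have "(\<lambda>_. 0) \<in> L1_dual N" by (auto simp: L1_dual_def intro!: exI[of _ 0])
  then show "x \<in> L1 N" using limitin_initial_topology_imp(1)[OF lim] by blast
  show "xs n \<in> L1 N" by (rule xs)
  show "(\<lambda>n. \<Lambda> (xs n)) \<longlonglongrightarrow> \<Lambda> x" if "\<Lambda> \<in> dual_ball N"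
    using limitin_initial_topology_imp(2)[OF lim] that dual_ball_subset_L1_dual by blast
qed

text \<open>One choice of weights serves all sets \<open>\<Omega> k\<close>: the \<open>j\<close>-th average is made close to \<open>x\<close> on \<open>\<Omega> j\<close>, which
contains \<open>\<Omega> k\<close> for \<open>j \<ge> k\<close>. The integral of the nonnegative bound \<open>G\<close> is controlled on each \<open>\<Omega> k\<close> by
the same constant, hence on the whole space by monotone convergence. As \<open>G\<close> is measurable, the
biconjugate, which need not be, can be bounded by an integrable function.\<close>
lemma biconjugate_dominated_by_integrable:
  fixes xs :: "nat \<Rightarrow> 'a \<Rightarrow> 'e::{banach, second_countable_topology}"
  assumes reflexive: "reflexive_space TYPE('e)" and r: "strict_mono r"
    and biting: "biting_converges M xs x"
    and meas: "\<And>m. xs m \<in> borel_measurable M" "x \<in> borel_measurable M"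
    and v: "\<And>m. integrable M (v m)" "\<And>m. (\<integral>\<omega>. v m \<omega> \<partial>M) \<le> B"
      "\<And>m. AE \<omega> in M. f (r m) \<omega> (xs m \<omega>) = ereal (v m \<omega>)"
    and H: "integrable M H" "\<And>\<omega>. 0 \<le> H \<omega>" "\<And>m. (\<integral>\<omega>. max (- v m \<omega> - H \<omega>) 0 \<partial>M) \<le> \<epsilon>"
  obtains u where "integrable M u" "(\<integral>\<omega>. u \<omega> \<partial>M) \<le> B + \<epsilon>"
    "AE \<omega> in M. biconjugate (seq_li_e weak_topology (\<lambda>n. f n \<omega>)) (x \<omega>) \<le> ereal (u \<omega>)"
proof -
  note [measurable] = meas
  obtain \<Omega> where \<Omega>: "incseq \<Omega>" "\<And>k. \<Omega> k \<in> sets M" "AE \<omega> in M. \<omega> \<in> (\<Union>k. \<Omega> k)"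
    and weak: "\<And>k. weakly_converges_L1 (restrict_space M (\<Omega> k)) xs x"
    using biting unfolding biting_converges_def by blast
  note [measurable] = \<Omega>(2)
  define N where "N k = restrict_space M (\<Omega> k)" for k
  note weakN = weakly_converges_L1_dual_ball[OF weak, folded N_def]
  define d where "d m \<omega> = xs m \<omega> - x \<omega>" for m \<omega>
  have [measurable]: "d m \<in> borel_measurable M" for m unfolding d_def by measurable
  have dL: "d m \<in> L1 (N k)" for m k using weakN(1)[of m k] weakN(2)[of k] by (auto simp: L1_def d_def[abs_def])
  have "(\<lambda>m. \<Lambda> (d m)) \<longlonglongrightarrow> 0" if \<Lambda>: "\<Lambda> \<in> dual_ball (N k)" for \<Lambda> k
  proof -
    have "\<Lambda> (d m) = \<Lambda> (xs m) - \<Lambda> x" for m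
      using dual_ballD(1)[OF \<Lambda> dL[of m] weakN(2)[of k]] by (simp add: d_def)
    then show ?thesis using tendsto_diff[OF weakN(3)[OF \<Lambda>] tendsto_const[of "\<Lambda> x"]] by simp
  qed
  then have "\<exists>q w. tail_weights j q w \<and> L1_norm (N j) (\<lambda>\<omega>. \<Sum>m=j..<q. w m *\<^sub>R d m \<omega>) < (1/2) ^ j" for j
    using dL by (intro mazur_L1) auto
  then have "\<forall>j. \<exists>qw. tail_weights j (fst qw) (snd qw) \<and>
      L1_norm (N j) (\<lambda>\<omega>. \<Sum>m=j..<fst qw. snd qw m *\<^sub>R d m \<omega>) < (1/2) ^ j"
    by simp
  from choice[OF this] obtain qw :: "nat \<Rightarrow> nat \<times> (nat \<Rightarrow> real)" where
    qw: "\<forall>j. tail_weights j (fst (qw j)) (snd (qw j)) \<and>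
      L1_norm (N j) (\<lambda>\<omega>. \<Sum>m=j..<fst (qw j). snd (qw j) m *\<^sub>R d m \<omega>) < (1/2) ^ j" by (elim exE)
  define q w where "q j = fst (qw j)" and "w j = snd (qw j)" for j
  have w: "tail_weights j (q j) (w j)"
    and small: "L1_norm (N j) (\<lambda>\<omega>. \<Sum>m=j..<q j. w j m *\<^sub>R d m \<omega>) < (1/2) ^ j" for j
    using qw by (simp_all add: q_def w_def)
  have w1: "(\<Sum>m=j..<q j. w j m) = 1" for j using w[of j] by (simp add: tail_weights_def)
  have lim: "AE \<omega> in M. (\<lambda>j. \<Sum>m=j..<q j. w j m *\<^sub>R xs m \<omega>) \<longlonglongrightarrow> x \<omega>"
  proof -
    have "AE \<omega> in M. (\<lambda>j. \<Sum>m=j..<q j. w j m *\<^sub>R d m \<omega>) \<longlonglongrightarrow> 0"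
    proof (rule averages_converge_AE[OF \<Omega>])
      show "(\<lambda>\<omega>. \<Sum>m=j..<q j. w j m *\<^sub>R d m \<omega>) \<in> L1 (restrict_space M (\<Omega> j))" for j
        using dL[of _ j] by (auto simp: L1_def N_def)
    qed (use small in \<open>auto simp: N_def\<close>)
    then show ?thesis
    proof eventually_elim
      case (elim \<omega>)
      have "(\<Sum>m=j..<q j. w j m *\<^sub>R d m \<omega>) = (\<Sum>m=j..<q j. w j m *\<^sub>R xs m \<omega>) - x \<omega>" for j
        by (simp add: d_def scaleR_diff_right sum_subtractf scaleR_sum_left[symmetric] w1)
      then show ?case using elim by (simp add: LIM_zero_iff)
    qed
  qed
  define p where "p m \<omega> = max (v m \<omega>) (- H \<omega>) + H \<omega>" for m \<omega>
  define C where "C = B + \<epsilon> + (\<integral>\<omega>. H \<omega> \<partial>M)"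
  have p0: "0 \<le> p m \<omega>" for m \<omega> by (simp add: p_def)
  have p_eq: "p m \<omega> = v m \<omega> + max (- v m \<omega> - H \<omega>) 0 + H \<omega>" for m \<omega> by (auto simp: p_def)
  have maxi: "integrable M (\<lambda>\<omega>. max (- v m \<omega> - H \<omega>) 0)" for m using v(1) H(1) by auto
  have pint: "integrable M (p m)" for m unfolding p_eq[abs_def] using v(1) H(1) maxi by auto
  have pC: "(\<integral>\<omega>. p m \<omega> \<partial>M) \<le> C" for m
    unfolding p_eq C_def using v(1) H(1) maxi v(2)[of m] H(3)[of m] by simp
  have C0: "0 \<le> C" using Bochner_Integration.integral_nonneg[of M "p 0"] pC[of 0] p0 by fastforce
  define G where "G \<omega> = (SUP K. INF R. liminf (\<lambda>j. ennreal (penalized_average q w (\<lambda>m. xs m \<omega>) (\<lambda>m. p m \<omega>) K R j)))" for \<omega>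
  have [measurable]: "p m \<in> borel_measurable M" for m using pint by auto
  have [measurable]: "(\<lambda>\<omega>. penalized_average q w (\<lambda>m. xs m \<omega>) (\<lambda>m. p m \<omega>) K R j) \<in> borel_measurable M" for K R j
    unfolding penalized_average_def by measurable
  have G_meas [measurable]: "G \<in> borel_measurable M" unfolding G_def by measurable
  have G_k: "(\<integral>\<^sup>+\<omega>. G \<omega> * indicator (\<Omega> k) \<omega> \<partial>M) \<le> ennreal C" for k
  proof -
    have rest: "integrable (N k) (p m)" "(\<integral>\<omega>. p m \<omega> \<partial>N k) \<le> C" for m
    proof -
      have i: "integrable M (\<lambda>\<omega>. indicator (\<Omega> k) \<omega> *\<^sub>R p m \<omega>)"
        using integrable_mult_indicator[OF \<Omega>(2) pint] .
      then show "integrable (N k) (p m)" unfolding N_def by (subst integrable_restrict_space) auto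
      have "(\<integral>\<omega>. p m \<omega> \<partial>N k) = (\<integral>\<omega>. indicator (\<Omega> k) \<omega> *\<^sub>R p m \<omega> \<partial>M)"
        unfolding N_def by (subst integral_restrict_space) auto
      also have "\<dots> \<le> (\<integral>\<omega>. p m \<omega> \<partial>M)"
        using i pint p0 by (intro integral_mono) (auto simp: indicator_def)
      finally show "(\<integral>\<omega>. p m \<omega> \<partial>N k) \<le> C" using pC[of m] by linarith
    qed
    have "\<exists>R n. \<forall>m\<ge>n. (\<integral>\<omega>. (if norm (xs m \<omega>) > R then norm (xs m \<omega>) else 0) \<partial>N k) \<le> e" if "e > 0" for e
      by (rule weakly_convergent_L1_uniformly_integrable[OF weakN(1) weakN(2) weakN(3) that]) blast+
    then have "integral\<^sup>N (N k) G \<le> ennreal C"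
      unfolding G_def using w weakN(1) rest p0 by (intro nn_integral_penalized_averages_le) auto
    then show ?thesis unfolding N_def by (simp add: nn_integral_restrict_space)
  qed
  have G_int: "(\<integral>\<^sup>+\<omega>. G \<omega> \<partial>M) \<le> ennreal C"
  proof -
    have inc: "incseq (\<lambda>k \<omega>. G \<omega> * indicator (\<Omega> k) \<omega>)"
      using \<Omega>(1) by (auto simp: incseq_def le_fun_def indicator_def)
    have "(\<integral>\<^sup>+\<omega>. G \<omega> \<partial>M) = (\<integral>\<^sup>+\<omega>. (SUP k. G \<omega> * indicator (\<Omega> k) \<omega>) \<partial>M)"
    proof (rule nn_integral_cong_AE)
      show "AE \<omega> in M. G \<omega> = (SUP k. G \<omega> * indicator (\<Omega> k) \<omega>)" using \<Omega>(3)
      proof eventually_elim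
        case (elim \<omega>)
        then obtain k where "\<omega> \<in> \<Omega> k" by blast
        then show ?case by (intro antisym SUP_least SUP_upper2[of k]) (auto simp: indicator_def)
      qed
    qed
    also have "\<dots> = (SUP k. \<integral>\<^sup>+\<omega>. G \<omega> * indicator (\<Omega> k) \<omega> \<partial>M)"
      using inc by (intro nn_integral_monotone_convergence_SUP) auto
    also have "\<dots> \<le> ennreal C" by (intro SUP_least G_k)
    finally show ?thesis .
  qed
  have G_fin: "AE \<omega> in M. G \<omega> \<noteq> \<infinity>"
    using G_int by (intro nn_integral_PInf_AE) (auto simp: top_unique)
  have Gi: "integrable M (\<lambda>\<omega>. enn2real (G \<omega>))" and GC: "(\<integral>\<omega>. enn2real (G \<omega>) \<partial>M) \<le> C"
  proof -
    have eq: "(\<integral>\<^sup>+\<omega>. ennreal (enn2real (G \<omega>)) \<partial>M) = (\<integral>\<^sup>+\<omega>. G \<omega> \<partial>M)"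
      using G_fin by (intro nn_integral_cong_AE) (auto simp: less_top)
    show "integrable M (\<lambda>\<omega>. enn2real (G \<omega>))"
      using G_int eq by (intro integrableI_nonneg) (auto intro: le_less_trans)
    then have "ennreal (\<integral>\<omega>. enn2real (G \<omega>) \<partial>M) \<le> ennreal C"
      using G_int eq by (subst nn_integral_eq_integral[symmetric]) auto
    then show "(\<integral>\<omega>. enn2real (G \<omega>) \<partial>M) \<le> C" using C0 by simp
  qed
  show ?thesis
  proof (rule that[of "\<lambda>\<omega>. enn2real (G \<omega>) - H \<omega>"])
    show "integrable M (\<lambda>\<omega>. enn2real (G \<omega>) - H \<omega>)" using Gi H(1) by simp
    show "(\<integral>\<omega>. enn2real (G \<omega>) - H \<omega> \<partial>M) \<le> B + \<epsilon>" using Gi H(1) GC by (simp add: C_def)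
    have "AE \<omega> in M. \<forall>m. f (r m) \<omega> (xs m \<omega>) = ereal (v m \<omega>)" using v(3) by (simp add: AE_all_countable)
    then show "AE \<omega> in M. biconjugate (seq_li_e weak_topology (\<lambda>n. f n \<omega>)) (x \<omega>) \<le> ereal (enn2real (G \<omega>) - H \<omega>)"
      using lim G_fin
    proof eventually_elim
      case (elim \<omega>)
      show ?case
      proof (rule biconjugate_leI)
        fix \<phi> :: "'e \<Rightarrow>\<^sub>L real" and c
        assume c: "conjugate (seq_li_e weak_topology (\<lambda>n. f n \<omega>)) \<phi> \<le> ereal c"
        have "f (r m) \<omega> (xs m \<omega>) \<le> ereal (p m \<omega> - H \<omega>)" for m using elim(1) by (simp add: p_def)
        then have "ennreal (blinfun_apply \<phi> (x \<omega>) - c + H \<omega>) \<le> G \<omega>"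
          unfolding G_def
          by (intro conjugate_bound_penalized_average[where g = "\<lambda>n. f n \<omega>", OF reflexive r w elim(2) p0 _ H(2) c])
        then have "ennreal (blinfun_apply \<phi> (x \<omega>) - c + H \<omega>) \<le> ennreal (enn2real (G \<omega>))"
          using elim(3) by (simp add: less_top)
        then show "ereal (blinfun_apply \<phi> (x \<omega>) - c) \<le> ereal (enn2real (G \<omega>) - H \<omega>)"
          by (simp add: ennreal_le_iff)
      qed
    qed
  qed
qed

lemma rep_borel_measurable:
  assumes "c \<in> L0 M"
  shows "rep c \<in> borel_measurable M"
proof -
  obtain a where a: "a \<in> borel_measurable M" "c = ae_equal M `` {a}"
    using assms by (auto simp: L0_def quotient_def)
  then have "a \<in> c" by (simp add: ae_equal_def)
  then have "rep c \<in> c" unfolding rep_def by (rule someI[of "\<lambda>y. y \<in> c"])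
  then show ?thesis using a by (simp add: ae_equal_def)
qed

theorem corollary6p7:
  fixes M :: "'a measure"
    and T :: "('a \<Rightarrow> 'e::{banach, second_countable_topology}) set topology"
    and x :: "('a \<Rightarrow> 'e) set"
    and f :: "nat \<Rightarrow> 'a \<Rightarrow> 'e \<Rightarrow> ereal"
  assumes "sigma_finite_measure M" and "complete_measure M"
    and "reflexive_space TYPE('e)"
    and "topspace T \<subseteq> L0 M"
    and "x \<in> topspace T"
    and "\<And>xs. (\<forall>n. xs n \<in> topspace T) \<Longrightarrow> limitin T xs x sequentially \<Longrightarrow>
           biting_converges M (\<lambda>n. rep (xs n)) (rep x)"
    and "\<And>n. (\<lambda>(\<omega>, e). f n \<omega> e) \<in> borel_measurable (M \<Otimes>\<^sub>M borel)"
    and "ioffe_criterion M T f x"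
  shows "seq_li_e T (\<lambda>n. integral_functional M (f n)) x \<ge>
    integral_functional M (\<lambda>\<omega>. biconjugate (seq_li_e weak_topology (\<lambda>n. f n \<omega>))) x"
proof -
  let ?I = "integral_functional M (\<lambda>\<omega>. biconjugate (seq_li_e weak_topology (\<lambda>n. f n \<omega>))) x"
  have "?I \<le> liminf (\<lambda>n. integral_functional M (f n) (xs n))"
    if xs: "\<forall>n. xs n \<in> topspace T" and lim: "limitin T xs x sequentially" for xs
  proof (rule ccontr)
    assume "\<not> ?thesis"
    then have "liminf (\<lambda>n. integral_functional M (f n) (xs n)) < ?I" by (simp only: not_le)
    from ereal_dense2[OF this]
    obtain B where B: "liminf (\<lambda>n. integral_functional M (f n) (xs n)) < ereal B" "ereal B < ?I" by blast
    have "\<not> eventually (\<lambda>n. ereal B \<le> integral_functional M (f n) (xs n)) sequentially"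
    proof
      assume "eventually (\<lambda>n. ereal B \<le> integral_functional M (f n) (xs n)) sequentially"
      from Liminf_bounded[OF this] show False using B(1) by (simp add: not_le[symmetric])
    qed
    from not_eventually_sequentiallyD[OF this]
    obtain s :: "nat \<Rightarrow> nat" where s: "strict_mono s"
      and less: "\<And>k. integral_functional M (f (s k)) (xs (s k)) < ereal B" by (auto simp: not_le)
    have "limitin T (\<lambda>k. xs (s k)) x sequentially" using limitin_subsequence[OF s lim] by (simp add: o_def)
    moreover have "\<exists>C::real. \<forall>k. integral_functional M (f (s k)) (xs (s k)) \<le> ereal C"
      using less by (intro exI[of _ B] allI less_imp_le)
    ultimately have "lower_compactness M (\<lambda>k. f (s k)) (\<lambda>k. rep (xs (s k)))"
      using xs by (intro assms(8)[unfolded ioffe_criterion_def, rule_format, OF s]) simp_all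
    then obtain n0 where
      fin: "\<forall>n\<ge>n0. AE \<omega> in M. neg_part (f (s n) \<omega> (rep (xs (s n)) \<omega>)) < \<infinity>" and
      UI: "uniformly_integrable M ((\<lambda>n \<omega>. real_of_ereal (neg_part (f (s n) \<omega> (rep (xs (s n)) \<omega>)))) ` {n0..})"
      unfolding lower_compactness_def by (elim exE conjE)
    define r where "r k = s (k + n0)" for k
    have r: "strict_mono r" using s by (simp add: strict_mono_def r_def)
    define X where "X m = rep (xs (r m))" for m
    define V where "V m \<omega> = f (r m) \<omega> (X m \<omega>)" for m \<omega>
    define v where "v m \<omega> = real_of_ereal (V m \<omega>)" for m \<omega>
    define U where "U m \<omega> = real_of_ereal (neg_part (V m \<omega>))" for m \<omega>
    have X [measurable]: "X m \<in> borel_measurable M" for m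
      unfolding X_def using xs assms(4) by (intro rep_borel_measurable) blast
    have V_meas: "V m \<in> borel_measurable M" for m
    proof -
      have "(\<lambda>\<omega>. (\<omega>, X m \<omega>)) \<in> M \<rightarrow>\<^sub>M (M \<Otimes>\<^sub>M borel)" by measurable
      from measurable_compose[OF this assms(7)[of "r m"]] show ?thesis by (simp add: V_def[abs_def])
    qed
    have "range U = (\<lambda>n \<omega>. real_of_ereal (neg_part (f (s n) \<omega> (rep (xs (s n)) \<omega>)))) ` {n0..}"
      (is "_ = ?F ` _")
    proof -
      have U_eq: "U = (\<lambda>m. ?F (m + n0))" by (simp add: fun_eq_iff U_def V_def X_def r_def)
      have "n \<in> range (\<lambda>m. m + n0) \<longleftrightarrow> n \<in> {n0..}" for n
        by (auto intro: image_eqI[of _ _ "n - n0"])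
      then have "range (\<lambda>m. m + n0) = {n0..}" by blast
      then show ?thesis using U_eq image_image[of ?F "\<lambda>m. m + n0" UNIV] by simp
    qed
    then have UI_U: "uniformly_integrable M (range U)" using UI by (simp only:)
    have U_pos: "\<forall>u\<in>range U. \<forall>\<omega>. 0 \<le> u \<omega>"
      by (auto simp: U_def neg_part_def intro!: real_of_ereal_pos)
    have Ui: "integrable M (U m)" for m
    proof -
      have "range U \<subseteq> L1 M"
        using UI_U unfolding uniformly_integrable_def equi_integrable_def by (elim conjE)
      then show ?thesis by (auto simp: L1_def)
    qed
    have V_fin: "AE \<omega> in M. neg_part (V m \<omega>) < \<infinity>" for m
      using fin[rule_format, of "m + n0"] by (simp add: V_def X_def r_def)
    have V_less: "upper_integral M (V m) < ereal B" for m
      using less[of "m + n0"] by (simp add: integral_functional_def V_def[abs_def] X_def r_def)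
    note V = upper_integral_less_imp_integrable[OF V_meas V_fin Ui[unfolded U_def[abs_def]] V_less, folded v_def]
    have v: "integrable M (v m)" "(\<integral>\<omega>. v m \<omega> \<partial>M) \<le> B" "AE \<omega> in M. f (r m) \<omega> (X m \<omega>) = ereal (v m \<omega>)" for m
      using V[of m] by (simp_all add: v_def[abs_def] V_def)
    have x_meas: "rep x \<in> borel_measurable M" using assms(4,5) by (intro rep_borel_measurable) blast
    have biting: "biting_converges M X (rep x)"
      using assms(6)[of "xs \<circ> r"] xs limitin_subsequence[OF r lim] by (simp add: X_def[abs_def])
    have "?I \<le> ereal (B + \<epsilon>)" if \<epsilon>: "\<epsilon> > 0" for \<epsilon>
    proof -
      obtain H where H_int: "integrable M H" and H0_all: "\<forall>\<omega>. 0 \<le> H \<omega>"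
        and HU_all: "\<forall>u\<in>range U. (\<integral>\<omega>. max (u \<omega> - H \<omega>) 0 \<partial>M) \<le> \<epsilon>"
        by (rule uniformly_integrable_dominated_up_to[OF UI_U U_pos \<epsilon>])
      have HU: "(\<integral>\<omega>. max (U m \<omega> - H \<omega>) 0 \<partial>M) \<le> \<epsilon>" for m using HU_all by blast
      have H: "integrable M H" "0 \<le> H \<omega>" for \<omega> using H_int H0_all by auto
      have Hv: "(\<integral>\<omega>. max (- v m \<omega> - H \<omega>) 0 \<partial>M) \<le> \<epsilon>" for m
      proof -
        have "- v m \<omega> \<le> U m \<omega>" for \<omega>
          by (cases "V m \<omega>") (auto simp: v_def U_def neg_part_def max_def)
        then have "max (- v m \<omega> - H \<omega>) 0 \<le> max (U m \<omega> - H \<omega>) 0" for \<omega>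
          by (intro max.mono) (auto simp: diff_right_mono)
        then have "(\<integral>\<omega>. max (- v m \<omega> - H \<omega>) 0 \<partial>M) \<le> (\<integral>\<omega>. max (U m \<omega> - H \<omega>) 0 \<partial>M)"
          using v(1)[of m] Ui[of m] H(1) by (intro integral_mono) auto
        then show ?thesis using HU[of m] by linarith
      qed
      show ?thesis
      proof (rule biconjugate_dominated_by_integrable[where M = M and f = f and r = r and xs = X
            and x = "rep x" and v = v and H = H and B = B and \<epsilon> = \<epsilon>])
        fix u assume u: "integrable M u" "(\<integral>\<omega>. u \<omega> \<partial>M) \<le> B + \<epsilon>"
          "AE \<omega> in M. biconjugate (seq_li_e weak_topology (\<lambda>n. f n \<omega>)) (rep x \<omega>) \<le> ereal (u \<omega>)"
        have "?I \<le> ereal (\<integral>\<omega>. u \<omega> \<partial>M)"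
          unfolding integral_functional_def upper_integral_def
          by (intro Inf_lower CollectI exI[of _ u] conjI refl u)
        also have "\<dots> \<le> ereal (B + \<epsilon>)" using u(2) by simp
        finally show ?thesis .
      qed (fact assms(3) r biting X x_meas v H Hv)+
    qed
    then have le: "?I \<le> ereal B + ereal \<epsilon>" if "\<epsilon> > 0" for \<epsilon>
      using that by (simp only: plus_ereal.simps)
    have "?I \<le> ereal B" by (rule ereal_le_epsilon2) (intro allI impI le)
    then show False using B(2) by (rule leD[THEN notE])
  qed
  then show ?thesis unfolding seq_li_e_def[of T]
    by (intro Inf_greatest, elim CollectE exE conjE) (simp only:)
qed

end
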